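(* Let $p\equiv 1 \pmod{12}$ be prime and let $\xi$ be a multiplicative character of $\mathbb{F}_p^\times$ of order $12$. For $t\in\mathbb{F}_p\setminus\{0,1\}$ let $E_t$ be the elliptic curve over $\mathbb{F}_p$ given by $y^2=4x^3-\frac{27}{1-t}x-\frac{27}{1-t}$, and let $a(t,p)=p+1-\#E_t(\mathbb{F}_p)$, where $\#E_t(\mathbb{F}_p)$ counts the solutions $(x,y)\in\mathbb{F}_p^2$ of this equation plus the point at infinity. Then for every $t\in\mathbb{F}_p\setminus\{0,1\}$, $$p\,{}_2F_1\!\left(\begin{matrix}\xi, & \xi^5\\ & \varepsilon\end{matrix}\,\Big|\, t\right)=\psi(t)\,a(t,p),$$ where $\psi(t)=-\phi(2)\,\xi^{-3}(1-t)$.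
   Context: Every multiplicative character $\chi$ of $\mathbb{F}_p^\times$ is extended to $\mathbb{F}_p$ by $\chi(0)=0$; $\varepsilon$ denotes the trivial character and $\phi$ the quadratic character. For characters $A,B$ define $\binom{A}{B}=\frac{B(-1)}{p}\sum_{x\in\mathbb{F}_p}A(x)\overline{B}(1-x)$. For characters $A,B,C$ and $x\in\mathbb{F}_p$, Greene's hypergeometric function is ${}_2F_1\!\left(\begin{matrix}A, & B\\ & C\end{matrix}\,\Big|\, x\right)=\frac{p}{p-1}\sum_{\chi}\binom{A\chi}{\chi}\binom{B\chi}{C\chi}\chi(x)$, the sum over all multiplicative characters $\chi$ of $\mathbb{F}_p^\times$. *)

theory Defs
  imports
    Complex_Main
    "HOL-Number_Theory.Cong"
    "Berlekamp_Zassenhaus.Finite_Field"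
begin

text \<open>
  The prime field with \<open>p = CARD('p)\<close> elements is \<^typ>\<open>'p mod_ring\<close> for \<open>'p :: prime_card\<close>.
  A multiplicative character is a homomorphism from the nonzero elements to the nonzero
  complex numbers, represented by its extension by zero to the whole field.
\<close>

definition mult_chars :: "('p::prime_card mod_ring \<Rightarrow> complex) set" where
  "mult_chars = {\<chi>. \<chi> 0 = 0 \<and> (\<forall>x. x \<noteq> 0 \<longrightarrow> \<chi> x \<noteq> 0) \<and> (\<forall>x y. \<chi> (x * y) = \<chi> x * \<chi> y)}"

definition triv_char :: "'p::prime_card mod_ring \<Rightarrow> complex" where
  "triv_char x = (if x = 0 then 0 else 1)"

definition quad_char :: "'p::prime_card mod_ring \<Rightarrow> complex" where
  "quad_char x = (if x = 0 then 0 else if \<exists>y. x = y ^ 2 then 1 else -1)"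

definition char_mult ::
  "('p::prime_card mod_ring \<Rightarrow> complex) \<Rightarrow> ('p mod_ring \<Rightarrow> complex) \<Rightarrow> 'p mod_ring \<Rightarrow> complex" where
  "char_mult A B x = A x * B x"

text \<open>The case distinction keeps the value at zero equal to zero also for the exponent zero.\<close>

definition char_power ::
  "('p::prime_card mod_ring \<Rightarrow> complex) \<Rightarrow> int \<Rightarrow> 'p mod_ring \<Rightarrow> complex" where
  "char_power \<chi> k x = (if x = 0 then 0 else \<chi> x powi k)"

definition char_order :: "('p::prime_card mod_ring \<Rightarrow> complex) \<Rightarrow> nat" where
  "char_order \<chi> = (LEAST n. n > 0 \<and> char_power \<chi> (int n) = triv_char)"

definition char_binom ::
  "('p::prime_card mod_ring \<Rightarrow> complex) \<Rightarrow> ('p mod_ring \<Rightarrow> complex) \<Rightarrow> complex" where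
  "char_binom A B =
     B (-1) / of_nat CARD('p) * (\<Sum>x\<in>UNIV. A x * cnj (B (1 - x)))"

definition greene_2F1 ::
  "('p::prime_card mod_ring \<Rightarrow> complex) \<Rightarrow> ('p mod_ring \<Rightarrow> complex) \<Rightarrow>
   ('p mod_ring \<Rightarrow> complex) \<Rightarrow> 'p mod_ring \<Rightarrow> complex" where
  "greene_2F1 A B C x =
     of_nat CARD('p) / (of_nat CARD('p) - 1) *
     (\<Sum>\<chi>\<in>mult_chars.
        char_binom (char_mult A \<chi>) \<chi> * char_binom (char_mult B \<chi>) (char_mult C \<chi>) * \<chi> x)"

definition curve_points :: "'p::prime_card mod_ring \<Rightarrow> ('p mod_ring \<times> 'p mod_ring) set" where
  "curve_points t = {(x, y). y ^ 2 = 4 * x ^ 3 - 27 / (1 - t) * x - 27 / (1 - t)}"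

text \<open>The summand 1 in the point count is the point at infinity.\<close>

definition curve_trace :: "'p::prime_card mod_ring \<Rightarrow> int" where
  "curve_trace t = int CARD('p) + 1 - int (card (curve_points t) + 1)"

end

theory Submission
  imports Defs "HOL-Number_Theory.Residue_Primitive_Roots"
begin

text \<open>
  Write \<open>r = 1 - t\<close>. Orthogonality of characters turns the left-hand side into
  \<open>F(r) = \<Sum>y. \<xi>\<^sup>5(y) \<xi>(1 - y) \<xi>\<^sup>-\<^sup>1(1 - r y)\<close>, and the trace is, up to a character value, the sum of
  \<open>\<phi>(4 r x\<^sup>3 - 27 x - 27)\<close>. The bridge between the two consists of pointwise forms of the
  Hasse-Davenport relations for the exponents 3 and 2.

  For the exponent 3 and \<open>\<omega> = \<xi>\<^sup>4\<close>, pushing \<open>\<omega>(y / z)\<close> forward along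
  \<open>(x, y, z) \<mapsto> (x + y + z, x y z)\<close> gives \<open>p\<close> times the counting measure of the curve \<open>(3 e, e\<^sup>3)\<close> minus
  a function of \<open>x y z\<close> alone. No Gauss sums are needed: both sides have the same Hermitian norm,
  and their inner product equals the square of that norm because it only involves the points
  \<open>(3 e, e\<^sup>3)\<close>, where the fibre is a rational nodal cubic on which \<open>y / z\<close> is a cube. Testing the
  identity against \<open>\<phi>(108 r b - 27 (a + 1))\<close> produces the curve on one side and, on the other,
  a summand inside \<open>\<phi>\<close> that is affine in \<open>x\<close>, so that the sum over \<open>x\<close> collapses.

  For the exponent 2 the fibres of \<open>(x, y) \<mapsto> (x + y, x y)\<close> are compared with the square roots \<open>e\<close> of
  \<open>x y\<close> through \<open>x (x + y + 2 e) = (x + e)\<^sup>2\<close>.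
\<close>

section \<open>The prime field\<close>

text \<open>Transfers a primitive root modulo \<open>p\<close> to the field; the exponents below
  \<open>p - 1\<close> then serve as discrete logarithms.\<close>

lemma primitive_root_exists:
  obtains g :: "'p::prime_card mod_ring"
  where "g \<noteq> 0" "bij_betw (\<lambda>i. g ^ i) {..<CARD('p) - 1} (- {0})"
proof -
  let ?p = "CARD('p)"
  have p: "prime ?p" by (rule prime_card)
  obtain g0 where g0: "residue_primroot ?p g0"
    using prime_primitive_root_exists[of ?p] p prime_gt_1_nat[OF p] by auto
  define g :: "'p mod_ring" where "g = of_nat g0"
  have g_nz: "g \<noteq> 0"
    using g0 p of_nat_0_mod_ring_dvd[of g0, where ?'a='p] unfolding g_def
    by (auto simp: residue_primroot_def prime_imp_coprime_nat coprime_absorb_left)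
  have tot: "totient ?p = ?p - 1"
    using p by (simp add: totient_prime)
  have sub: "- {0} \<subseteq> (\<lambda>i. g ^ i) ` {..<?p - 1}"
  proof
    fix x :: "'p mod_ring" assume "x \<in> - {0}"
    obtain n where n: "n < ?p" "x = of_nat n" using surj_of_nat_mod_ring by blast
    have "n > 0" using n \<open>x \<in> - {0}\<close> by (auto intro: Nat.gr0I)
    then have "n \<in> totatives ?p"
      using n p by (simp add: totatives_prime)
    then obtain i where i: "i < ?p - 1" "n = g0 ^ i mod ?p"
      using residue_primroot_is_generator[OF prime_gt_1_nat[OF p] g0] tot
      by (auto simp: bij_betw_def)
    have "x = g ^ i"
      unfolding n(2) i(2) g_def
      by (metis of_nat_mod_CHAR of_nat_power semiring_char_mod_ring)
    then show "x \<in> (\<lambda>i. g ^ i) ` {..<?p - 1}" using i by blast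
  qed
  have cd: "card (- {0 :: 'p mod_ring}) = ?p - 1"
    by (simp add: card_Diff_subset Compl_eq_Diff_UNIV)
  have eq: "(\<lambda>i. g ^ i) ` {..<?p - 1} = - {0}"
    by (rule sym, rule card_seteq[OF _ sub])
       (use cd card_image_le[of "{..<?p - 1}" "\<lambda>i. g ^ i"] in auto)
  moreover have "inj_on (\<lambda>i. g ^ i) {..<?p - 1}"
    by (rule eq_card_imp_inj_on) (simp_all only: eq cd, simp_all)
  ultimately show ?thesis using that[OF g_nz] by (auto simp: bij_betw_def)
qed

lemma power_CARD_minus_1:
  fixes x :: "'p::prime_card mod_ring"
  assumes "x \<noteq> 0"
  shows "x ^ (CARD('p) - 1) = 1"
proof -
  have "x * x ^ (CARD('p) - 1) = x"
    using finite_field_power_card_eq_same[of x] nontriv[where ?'a='p]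
    by (simp flip: power_Suc)
  then show ?thesis using assms by simp
qed

lemma sum_scale_mod_ring:
  fixes a :: "'p::prime_card mod_ring" and h :: "'p mod_ring \<Rightarrow> complex"
  assumes "a \<noteq> 0"
  shows "(\<Sum>x\<in>UNIV. h (a * x)) = (\<Sum>x\<in>UNIV. h x)"
  by (rule sum.reindex_bij_witness[of _ "\<lambda>x. x / a" "\<lambda>x. a * x"]) (use assms in auto)

section \<open>Multiplicative characters\<close>

context
  fixes \<chi> :: "'p::prime_card mod_ring \<Rightarrow> complex"
  assumes chi: "\<chi> \<in> mult_chars"
begin

lemma mult_char_0: "\<chi> 0 = 0"
  using chi by (simp add: mult_chars_def)

lemma mult_char_mult: "\<chi> (x * y) = \<chi> x * \<chi> y"
  using chi by (simp add: mult_chars_def)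

lemma mult_char_eq_0_iff: "\<chi> x = 0 \<longleftrightarrow> x = 0"
  using chi by (auto simp: mult_chars_def)

lemma mult_char_1: "\<chi> 1 = 1"
  using mult_char_mult[of 1 1] mult_char_eq_0_iff[of 1] by auto

lemma mult_char_power: "\<chi> (x ^ n) = \<chi> x ^ n"
  by (induction n) (simp_all add: mult_char_1 mult_char_mult)

lemma mult_char_inverse: "\<chi> (inverse x) = inverse (\<chi> x)"
proof (cases "x = 0")
  case False
  have "\<chi> (x * inverse x) = 1" using False by (simp add: mult_char_1)
  then show ?thesis by (simp add: mult_char_mult inverse_unique)
qed (simp add: mult_char_0)

lemma mult_char_divide: "\<chi> (x / y) = \<chi> x / \<chi> y"
  by (simp add: divide_inverse mult_char_mult mult_char_inverse)

lemma mult_char_power_CARD: "x \<noteq> 0 \<Longrightarrow> \<chi> x ^ (CARD('p) - 1) = 1"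
  by (metis mult_char_power power_CARD_minus_1 mult_char_1)

lemma norm_mult_char: "x \<noteq> 0 \<Longrightarrow> norm (\<chi> x) = 1"
  using mult_char_power_CARD[of x] nontriv[where ?'a='p]
  by (metis norm_ge_zero norm_one norm_power power_eq_1_iff zero_less_diff not_gr_zero)

lemma cnj_mult_char: "cnj (\<chi> x) = inverse (\<chi> x)"
proof (cases "x = 0")
  case False
  then show ?thesis
    using norm_mult_char[OF False] complex_norm_square[of "\<chi> x"]
    by (simp add: inverse_unique)
qed (simp add: mult_char_0)

lemma sum_mult_char_eq_0:
  assumes "a \<noteq> 0" "\<chi> a \<noteq> 1"
  shows "(\<Sum>x\<in>UNIV. \<chi> x) = 0"
proof -
  have "\<chi> a * (\<Sum>x\<in>UNIV. \<chi> x) = (\<Sum>x\<in>UNIV. \<chi> x)"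
    using sum_scale_mod_ring[OF assms(1), of \<chi>] by (simp add: mult_char_mult sum_distrib_left)
  then show ?thesis using assms(2) by (simp add: mult_cancel_right1)
qed

end

lemma mult_char_char_power:
  assumes "\<chi> \<in> mult_chars"
  shows "char_power \<chi> k \<in> mult_chars"
  using mult_char_eq_0_iff[OF assms] mult_char_mult[OF assms]
  by (auto simp: mult_chars_def char_power_def power_int_mult_distrib)

lemma char_mult_mult_chars:
  assumes "\<chi> \<in> mult_chars" "\<psi> \<in> mult_chars"
  shows "char_mult \<chi> \<psi> \<in> mult_chars"
  using assms by (auto simp: mult_chars_def char_mult_def)

section \<open>Orthogonality over the group of characters\<close>

text \<open>A character is determined by its value at a generator, and every root of unity of
  exponent \<open>p - 1\<close> occurs there. This yields both the number of characters and
  characters with a prescribed value at \<open>g\<close>.\<close>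

lemma bij_betw_mult_chars_roots_of_unity:
  fixes g :: "'p::prime_card mod_ring"
  assumes g0: "g \<noteq> 0" and g: "bij_betw (\<lambda>i. g ^ i) {..<CARD('p) - 1} (- {0})"
  shows "bij_betw (\<lambda>\<chi>. \<chi> g) mult_chars {z. z ^ (CARD('p) - 1) = 1}"
proof (rule bij_betwI')
  let ?n = "CARD('p) - 1"
  have n: "?n > 0" using nontriv[where ?'a='p] by simp
  have gpow: "\<exists>i<?n. x = g ^ i" if "x \<noteq> 0" for x
    using g that by (auto simp: bij_betw_def)
  show "(\<chi> g = \<psi> g) = (\<chi> = \<psi>)"
    if c: "\<chi> \<in> mult_chars" and d: "\<psi> \<in> mult_chars" for \<chi> \<psi> :: "'p mod_ring \<Rightarrow> complex"
  proof
    assume eq: "\<chi> g = \<psi> g"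
    show "\<chi> = \<psi>"
    proof
      fix x
      show "\<chi> x = \<psi> x"
      proof (cases "x = 0")
        case False
        then obtain i where "x = g ^ i" using gpow by blast
        then show ?thesis by (simp add: eq mult_char_power[OF c] mult_char_power[OF d])
      qed (simp add: mult_char_0[OF c] mult_char_0[OF d])
    qed
  qed simp
  show "\<chi> g \<in> {z. z ^ ?n = 1}" if "\<chi> \<in> mult_chars" for \<chi> :: "'p mod_ring \<Rightarrow> complex"
    using mult_char_power_CARD[OF that g0] by simp
  show "\<exists>\<chi>\<in>mult_chars. z = \<chi> g" if "z \<in> {z. z ^ ?n = 1}" for z
  proof -
    \<comment> \<open>Prescribing \<open>z\<close> at \<open>g\<close> extends multiplicatively:
      \<open>g\<close> and \<open>z\<close> both have trivial power \<open>p - 1\<close>, so the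
      discrete logarithm matters only modulo \<open>p - 1\<close>.\<close>
    define dlog where "dlog = inv_into {..<?n} (\<lambda>i. g ^ i)"
    define \<chi> where "\<chi> = (\<lambda>x. if x = 0 then 0 else z ^ dlog x)"
    have z: "z ^ ?n = 1" using that by simp
    have dlog: "dlog (g ^ i) = i mod ?n" for i
    proof -
      have "g ^ i = g ^ (i mod ?n) * (g ^ ?n) ^ (i div ?n)"
        by (metis mod_mult_div_eq power_add power_mult)
      then have "g ^ i = g ^ (i mod ?n)"
        using power_CARD_minus_1[OF g0] by simp
      then show ?thesis
        unfolding dlog_def using bij_betw_inv_into_left[OF g, of "i mod ?n"] n by simp
    qed
    have zmod: "z ^ (i mod ?n) = z ^ i" for i
    proof -
      have "z ^ i = z ^ (i mod ?n) * (z ^ ?n) ^ (i div ?n)"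
        by (metis mod_mult_div_eq power_add power_mult)
      then show ?thesis using z by simp
    qed
    have chi_pow: "\<chi> (g ^ i) = z ^ i" for i
      using g0 zmod[of i] by (simp add: \<chi>_def dlog)
    have "\<chi> (x * y) = \<chi> x * \<chi> y" for x y
    proof (cases "x = 0 \<or> y = 0")
      case False
      then obtain i j where "x = g ^ i" "y = g ^ j" using gpow by blast
      then show ?thesis by (simp add: chi_pow flip: power_add)
    qed (auto simp: \<chi>_def)
    moreover have "z \<noteq> 0" using z n by (metis not_gr_zero power_0_left zero_neq_one)
    ultimately have "\<chi> \<in> mult_chars" by (auto simp: mult_chars_def \<chi>_def)
    moreover have "\<chi> g = z" using chi_pow[of 1] by simp
    ultimately show ?thesis by blast
  qed
qed

text \<open>At \<open>x = 1\<close> the characters are counted. Otherwise some \<open>\<psi>\<close>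
  has \<open>\<psi> x \<noteq> 1\<close>; multiplication by \<open>\<psi>\<close> permutes the
  characters, so the sum equals \<open>\<psi> x\<close> times itself.\<close>

lemma sum_mult_chars:
  fixes x :: "'p::prime_card mod_ring"
  assumes "x \<noteq> 0"
  shows "(\<Sum>\<chi>\<in>mult_chars. \<chi> x) = (if x = 1 then of_nat CARD('p) - 1 else 0)"
proof -
  let ?n = "CARD('p) - 1"
  have n: "?n > 0" using nontriv[where ?'a='p] by simp
  obtain g :: "'p mod_ring" where g: "g \<noteq> 0" "bij_betw (\<lambda>i. g ^ i) {..<?n} (- {0})"
    by (rule primitive_root_exists)
  note bij = bij_betw_mult_chars_roots_of_unity[OF g]
  show ?thesis
  proof (cases "x = 1")
    case True
    have "card (mult_chars :: ('p mod_ring \<Rightarrow> complex) set) = ?n"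
      using bij_betw_same_card[OF bij] card_roots_unity_eq[OF n] by simp
    moreover have "(\<Sum>\<chi>\<in>mult_chars. \<chi> x) = (\<Sum>\<chi>\<in>(mult_chars :: ('p mod_ring \<Rightarrow> complex) set). 1)"
      using True by (intro sum.cong) (simp_all add: mult_char_1)
    ultimately show ?thesis using True n by (simp add: of_nat_diff)
  next
    case False
    obtain i where i: "i < ?n" "x = g ^ i" using g(2) assms by (auto simp: bij_betw_def)
    have "i \<noteq> 0" using False i by (intro notI) simp
    \<comment> \<open>A character sending the generator to a primitive root of unity is injective on
      the nonzero elements, hence separates \<open>x\<close> from \<open>1\<close>.\<close>
    obtain \<psi> where psi: "\<psi> \<in> mult_chars" "\<psi> g = cis (2 * pi / real ?n)"
    proof -
      have "cis (2 * pi / real ?n) ^ ?n = 1"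
        using n by (simp add: DeMoivre)
      then have "cis (2 * pi / real ?n) \<in> (\<lambda>\<chi>. \<chi> g) ` mult_chars"
        using bij by (simp add: bij_betw_def)
      then show ?thesis using that by force
    qed
    have "\<psi> x = cis (2 * pi * real i / real ?n)"
      using psi by (simp add: i mult_char_power DeMoivre algebra_simps)
    moreover have "cis (2 * pi * real i / real ?n) \<noteq> 1"
    proof
      assume "cis (2 * pi * real i / real ?n) = 1"
      then have "cis (2 * pi * real i / real ?n) = cis (2 * pi * real 0 / real ?n)" by simp
      moreover have "inj_on (\<lambda>k. cis (2 * pi * real k / real ?n)) {..<?n}"
        using bij_betw_roots_unity[OF n] by (simp add: bij_betw_def)
      ultimately show False using i n \<open>i \<noteq> 0\<close> by (auto simp: inj_on_def)
    qed
    ultimately have ne: "\<psi> x \<noteq> 1" by simp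
    have "\<psi> x * (\<Sum>\<chi>\<in>mult_chars. \<chi> x) = (\<Sum>\<chi>\<in>mult_chars. char_mult \<psi> \<chi> x)"
      by (simp add: sum_distrib_left char_mult_def)
    also have "\<dots> = (\<Sum>\<chi>\<in>mult_chars. \<chi> x)"
    proof (rule sum.reindex_bij_witness[of _ "char_mult (char_power \<psi> (-1))" "char_mult \<psi>"])
      show "char_mult (char_power \<psi> (-1)) (char_mult \<psi> \<chi>) = \<chi>" if "\<chi> \<in> mult_chars" for \<chi>
        using mult_char_0[OF that] mult_char_eq_0_iff[OF psi(1)]
        by (auto simp: char_mult_def char_power_def power_int_minus)
      show "char_mult \<psi> (char_mult (char_power \<psi> (-1)) \<chi>) = \<chi>" if "\<chi> \<in> mult_chars" for \<chi>
        using mult_char_0[OF that] mult_char_eq_0_iff[OF psi(1)]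
        by (auto simp: char_mult_def char_power_def power_int_minus)
    qed (use psi in \<open>auto intro: char_mult_mult_chars mult_char_char_power\<close>)
    finally have "\<psi> x * (\<Sum>\<chi>\<in>mult_chars. \<chi> x) = (\<Sum>\<chi>\<in>mult_chars. \<chi> x)" .
    then show ?thesis using ne False by (simp add: mult_cancel_right1)
  qed
qed

section \<open>Push-forwards along maps of finite sets\<close>

text \<open>Each \<open>w\<close> lies in exactly one fibre of \<open>m\<close>. The inner sum is
  the push-forward of the weight \<open>F\<close>, the form in which \<open>fibre_sum\<close> is
  defined.\<close>

lemma sum_fibres:
  fixes m :: "'w::finite \<Rightarrow> 'i::finite" and F :: "'w \<Rightarrow> complex"
  shows "(\<Sum>i\<in>UNIV. (\<Sum>w\<in>UNIV. of_bool (m w = i) * F w) * h i) = (\<Sum>w\<in>UNIV. F w * h (m w))"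
proof -
  have "(\<Sum>i\<in>UNIV. (\<Sum>w\<in>UNIV. of_bool (m w = i) * F w) * h i)
      = (\<Sum>w\<in>UNIV. \<Sum>i\<in>UNIV. of_bool (m w = i) * F w * h i)"
    unfolding sum_distrib_right by (rule sum.swap)
  also have "\<dots> = (\<Sum>w\<in>UNIV. F w * h (m w))"
    by (intro sum.cong refl) (simp add: of_bool_def if_distrib if_distribR cong: if_cong)
  finally show ?thesis .
qed

text \<open>Expanding the squared norm of a push-forward pairs up the points of a common fibre. Used
  in both directions: to turn a norm into a weighted count of coincidences, and to evaluate such a
  count from a known push-forward.\<close>

lemma sum_norm_fibres:
  fixes m :: "'w::finite \<Rightarrow> 'i::finite" and F :: "'w \<Rightarrow> complex"
  shows "(\<Sum>w\<in>UNIV. \<Sum>w'\<in>UNIV. of_bool (m w = m w') * (F w * cnj (F w')))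
       = (\<Sum>i\<in>UNIV. (\<Sum>w\<in>UNIV. of_bool (m w = i) * F w) * cnj (\<Sum>w\<in>UNIV. of_bool (m w = i) * F w))"
  unfolding sum_fibres
  by (intro sum.cong refl) (auto simp: sum_distrib_left intro!: sum.cong)

lemma sum_UNIV_pair:
  "(\<Sum>q\<in>(UNIV :: ('a::finite \<times> 'b::finite) set). h q) = (\<Sum>y\<in>UNIV. \<Sum>z\<in>UNIV. h (y, z))"
  by (simp add: sum.cartesian_product UNIV_Times_UNIV split_def)

section \<open>The cubic identity\<close>

context
  fixes \<omega> :: "'p::prime_card mod_ring \<Rightarrow> complex" and \<zeta> :: "'p mod_ring"
  assumes omega: "\<omega> \<in> mult_chars"
    and omega_cube: "\<And>x. x \<noteq> 0 \<Longrightarrow> \<omega> x ^ 3 = 1"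
    and omega_nontrivial: "\<exists>x. x \<noteq> 0 \<and> \<omega> x \<noteq> 1"
    and zeta: "\<zeta>\<^sup>2 + \<zeta> + 1 = 0"
    and three_neq_0: "(3 :: 'p mod_ring) \<noteq> 0"
begin

section \<open>The weight \<open>\<omega> (y / z)\<close> on pairs\<close>

text \<open>The product form lets sums over the plane factor; it agrees with
  \<open>\<omega> (y / z)\<close> also for \<open>z = 0\<close>, where division gives
  \<open>0\<close>.\<close>

definition twist :: "'p mod_ring \<times> 'p mod_ring \<Rightarrow> complex" where
  "twist q = \<omega> (fst q) * cnj (\<omega> (snd q))"

lemmas omega_simps = mult_char_0[OF omega] mult_char_1[OF omega] mult_char_mult[OF omega]
  mult_char_eq_0_iff[OF omega] mult_char_divide[OF omega] mult_char_power[OF omega]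
  mult_char_inverse[OF omega]

lemma twist_eq: "twist (y, z) = \<omega> (y / z)"
  by (simp add: twist_def omega_simps cnj_mult_char[OF omega] divide_inverse)

lemma omega_minus: "\<omega> (- x) = \<omega> x"
proof -
  have "\<omega> (-1) = \<omega> ((-1) ^ 3)" by simp
  also have "\<dots> = 1" unfolding omega_simps by (rule omega_cube) simp
  finally have "\<omega> (-1) = 1" .
  then show ?thesis using mult_char_mult[OF omega, of "-1" x] by simp
qed

lemma omega_square: "(\<omega> x)\<^sup>2 = cnj (\<omega> x)"
proof (cases "x = 0")
  case False
  then have "\<omega> x * (\<omega> x)\<^sup>2 = 1"
    using omega_cube[of x] by (simp add: power3_eq_cube power2_eq_square mult.assoc)
  then show ?thesis by (simp add: cnj_mult_char[OF omega] inverse_unique)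
qed (simp add: omega_simps)

lemma sum_omega: "(\<Sum>x\<in>UNIV. \<omega> x) = 0"
  using omega_nontrivial sum_mult_char_eq_0[OF omega] by blast

lemma sum_cnj_omega: "(\<Sum>x\<in>UNIV. cnj (\<omega> x)) = 0"
  by (metis sum_omega cnj_sum complex_cnj_zero)

lemma sum_twist: "(\<Sum>q\<in>UNIV. twist q) = 0"
  by (simp add: sum_UNIV_pair twist_def sum_distrib_left[symmetric] sum_cnj_omega)

lemma sum_of_bool_nonzero: "(\<Sum>x\<in>UNIV. of_bool ((x::'p mod_ring) \<noteq> 0) :: complex) = of_nat CARD('p) - 1"
proof -
  have "(\<Sum>x\<in>UNIV. of_bool ((x::'p mod_ring) \<noteq> 0) :: complex)
      = (\<Sum>x\<in>UNIV. 1 - (if x = (0::'p mod_ring) then 1 else 0 :: complex))"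
    by (intro sum.cong) auto
  then show ?thesis by (simp add: sum_subtractf)
qed

text \<open>For \<open>a \<noteq> 0\<close> the quotient \<open>v = y / (a - y)\<close> runs through
  everything except \<open>-1\<close>, and the full sum of \<open>\<omega>\<close> is zero, so
  \<open>- \<omega> (-1) = -1\<close> remains. For \<open>a = 0\<close> each nonzero
  \<open>y\<close> contributes \<open>\<omega> (-1) = 1\<close>.\<close>

lemma sum_twist_add: "(\<Sum>q\<in>UNIV. of_bool (fst q + snd q = a) * twist q)
    = of_nat CARD('p) * of_bool (a = 0) - 1"
proof -
  have "(\<Sum>q\<in>UNIV. of_bool (fst q + snd q = a) * twist q)
      = (\<Sum>y\<in>UNIV. \<Sum>z\<in>UNIV. of_bool (z = a - y) * twist (y, z))"
    by (auto simp: sum_UNIV_pair algebra_simps intro!: sum.cong)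
  also have "\<dots> = (\<Sum>y\<in>UNIV. \<omega> (y / (a - y)))"
    by (intro sum.cong refl) (simp add: of_bool_def if_distrib if_distribR twist_eq cong: if_cong)
  also have "\<dots> = of_nat CARD('p) * of_bool (a = 0) - 1"
  proof (cases "a = 0")
    case True
    have "(\<Sum>y\<in>UNIV. \<omega> (y / (a - y))) = (\<Sum>y\<in>UNIV. of_bool ((y::'p mod_ring) \<noteq> 0))"
      using True by (intro sum.cong) (auto simp: omega_minus omega_simps)
    then show ?thesis using True by (simp add: sum_of_bool_nonzero)
  next
    case False
    have "(\<Sum>y\<in>UNIV. \<omega> (y / (a - y))) = (\<Sum>y\<in>UNIV - {a}. \<omega> (y / (a - y)))"
      by (rule sum.mono_neutral_right) (auto simp: omega_simps)
    also have "\<dots> = (\<Sum>v\<in>UNIV - {-1}. \<omega> v)"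
    proof (rule sum.reindex_bij_witness[of _ "\<lambda>v. a * v / (1 + v)" "\<lambda>y. y / (a - y)"])
      fix y assume "y \<in> UNIV - {a}"
      then have ne: "a - y \<noteq> 0" by simp
      have s: "1 + y / (a - y) = a / (a - y)" using ne by (simp add: field_simps)
      show "a * (y / (a - y)) / (1 + y / (a - y)) = y" unfolding s using ne False by simp
      show "y / (a - y) \<in> UNIV - {-1}" using s ne False by auto
    next
      fix v :: "'p mod_ring" assume "v \<in> UNIV - {-1}"
      then have ne: "1 + v \<noteq> 0" using add_eq_0_iff by blast
      have s: "a - a * v / (1 + v) = a / (1 + v)" using ne by (simp add: field_simps)
      show "a * v / (1 + v) / (a - a * v / (1 + v)) = v" unfolding s using ne False by simp
      show "a * v / (1 + v) \<in> UNIV - {a}" using s ne False by auto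
    qed simp
    also have "\<dots> = -1"
      by (simp add: sum_diff sum_omega omega_minus omega_simps)
    finally show ?thesis using False by simp
  qed
  finally show ?thesis .
qed

text \<open>Setting \<open>z = b / y\<close> turns the weight into
  \<open>\<omega> y ^ 2 / \<omega> b\<close>, and the square of \<open>\<omega>\<close> is its
  conjugate, again a character with sum zero.\<close>

lemma sum_twist_mult: "(\<Sum>q\<in>UNIV. of_bool (fst q * snd q = b) * twist q) = 0"
proof (cases "b = 0")
  case True
  then show ?thesis by (intro sum.neutral) (auto simp: twist_def omega_simps)
next
  case False
  have "(\<Sum>q\<in>UNIV. of_bool (fst q * snd q = b) * twist q)
      = (\<Sum>y\<in>UNIV. \<Sum>z\<in>UNIV. of_bool (y * z = b) * twist (y, z))"
    by (simp add: sum_UNIV_pair)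
  also have "\<dots> = (\<Sum>y\<in>UNIV. cnj (\<omega> y) * inverse (\<omega> b))"
  proof (intro sum.cong refl)
    fix y
    show "(\<Sum>z\<in>UNIV. of_bool (y * z = b) * twist (y, z)) = cnj (\<omega> y) * inverse (\<omega> b)"
    proof (cases "y = 0")
      case True
      then show ?thesis using False by (simp add: omega_simps)
    next
      case ne: False
      have "(\<Sum>z\<in>UNIV. of_bool (y * z = b) * twist (y, z))
          = (\<Sum>z\<in>UNIV. if z = b / y then twist (y, z) else 0)"
        using ne by (intro sum.cong) (auto simp: field_simps)
      also have "\<dots> = \<omega> y ^ 2 * inverse (\<omega> b)"
        by (simp add: twist_eq omega_simps power2_eq_square divide_inverse)
      finally show ?thesis by (simp add: omega_square)
    qed
  qed
  also have "\<dots> = 0" by (simp add: sum_distrib_right[symmetric] sum_cnj_omega)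
  finally show ?thesis .
qed

lemma norm_twist: "y \<noteq> 0 \<Longrightarrow> z \<noteq> 0 \<Longrightarrow> twist (y, z) * cnj (twist (y, z)) = 1"
  using norm_mult_char[OF omega, of "y / z"] complex_norm_square[of "\<omega> (y / z)"]
  by (simp add: twist_eq)

text \<open>Sum and product determine a pair up to order. Equal pairs contribute
  \<open>(p - 1)\<^sup>2\<close>; swapped pairs contribute \<open>twist (z, y)\<close>, with total
  zero; the pairs with \<open>y = z\<close> are counted twice, which costs
  \<open>p - 1\<close>.\<close>

lemma norm_sum_twist_add_mult:
  "(\<Sum>q\<in>UNIV. \<Sum>q'\<in>UNIV. of_bool ((fst q + snd q, fst q * snd q) = (fst q' + snd q', fst q' * snd q'))
      * (twist q * cnj (twist q'))) = (of_nat CARD('p) - 1) * (of_nat CARD('p) - 2)"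
proof -
  have "(\<Sum>q'\<in>UNIV. of_bool ((y + z, y * z) = (fst q' + snd q', fst q' * snd q'))
      * (twist (y, z) * cnj (twist q')))
      = of_bool (y \<noteq> 0) * of_bool (z \<noteq> 0) + twist (z, y) - (if y = z then of_bool (y \<noteq> 0) else 0)"
          for y z
  proof -
    have iff: "((y + z, y * z) = (fst q' + snd q', fst q' * snd q')) \<longleftrightarrow> q' \<in> {(y, z), (z, y)}" for q'
    proof
      assume "(y + z, y * z) = (fst q' + snd q', fst q' * snd q')"
      then have s: "snd q' = y + z - fst q'" and "y * z = fst q' * snd q'" by (auto simp: algebra_simps)
      moreover have "(fst q' - y) * (fst q' - z) = y * z - fst q' * (y + z - fst q')"
        by (simp add: algebra_simps)
      ultimately have "(fst q' - y) * (fst q' - z) = 0" by simp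
      then show "q' \<in> {(y, z), (z, y)}" using s by (cases q') auto
    qed (auto simp: algebra_simps)
    have "(\<Sum>q'\<in>UNIV. of_bool ((y + z, y * z) = (fst q' + snd q', fst q' * snd q'))
        * (twist (y, z) * cnj (twist q')))
        = (\<Sum>q'\<in>{(y, z), (z, y)}. twist (y, z) * cnj (twist q'))"
      unfolding iff by (rule sum.mono_neutral_cong_right) auto
    also have "\<dots> = twist (y, z) * cnj (twist (y, z))
        + (if y = z then 0 else twist (y, z) * cnj (twist (z, y)))"
      by auto
    \<comment> \<open>The left side is the square of \<open>twist (y, z)\<close>; since
      \<open>\<omega>\<close> is cubic, squaring is conjugation, which exchanges \<open>y\<close>
      and \<open>z\<close>.\<close>
    also have "twist (y, z) * cnj (twist (z, y)) = twist (z, y)"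
    proof -
      have "twist (y, z) * cnj (twist (z, y)) = (\<omega> y)\<^sup>2 * cnj ((\<omega> z)\<^sup>2)"
        by (simp add: twist_def power2_eq_square)
      then show ?thesis by (simp add: omega_square twist_def)
    qed
    also have "twist (y, z) * cnj (twist (y, z)) = of_bool (y \<noteq> 0) * of_bool (z \<noteq> 0)"
      using norm_twist[of y z] by (cases "y = 0"; cases "z = 0") (auto simp: twist_def omega_simps)
    finally show ?thesis by (auto simp: twist_eq omega_simps)
  qed
  then have "(\<Sum>q\<in>UNIV. \<Sum>q'\<in>UNIV. of_bool ((fst q + snd q, fst q * snd q)
      = (fst q' + snd q', fst q' * snd q'))
      * (twist q * cnj (twist q'))) = (\<Sum>y\<in>UNIV. \<Sum>z\<in>UNIV. of_bool (y \<noteq> 0) * of_bool (z \<noteq> 0) + twist (z, y)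
         - (if y = z then of_bool (y \<noteq> 0) else 0))"
    by (subst sum_UNIV_pair) simp
  also have "\<dots> = (of_nat CARD('p) - 1) * (of_nat CARD('p) - 1) + (\<Sum>y\<in>UNIV. \<Sum>z\<in>UNIV. twist (z, y))
      - (of_nat CARD('p) - 1)"
    by (simp add: sum.distrib sum_subtractf sum_distrib_left[symmetric] sum_distrib_right[symmetric]
        sum_of_bool_nonzero)
  also have "(\<Sum>y\<in>UNIV. \<Sum>z\<in>UNIV. twist (z, y)) = 0"
    by (subst sum.swap) (use sum_twist in \<open>simp add: sum_UNIV_pair\<close>)
  finally show ?thesis by (simp add: algebra_simps)
qed

section \<open>Push-forward along sum and product of triples\<close>

abbreviation sum_prod where
  "sum_prod w \<equiv> (fst w + (fst (snd w) + snd (snd w)), fst w * (fst (snd w) * snd (snd w)))"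

text \<open>Restricting to \<open>x \<noteq> 0\<close> confines the support to nonzero products,
  because \<open>twist\<close> already vanishes when \<open>y\<close> or \<open>z\<close> is zero.
  The plane \<open>x = 0\<close> is added back in \<open>cubic_sum_identity\<close>.\<close>

definition fibre_sum :: "'p mod_ring \<times> 'p mod_ring \<Rightarrow> complex" where
  "fibre_sum i = (\<Sum>w\<in>UNIV. of_bool (sum_prod w = i)
            * (of_bool (fst w \<noteq> 0) * twist (snd w)))"

text \<open>Eliminating \<open>x'\<close> leaves the linear equation
  \<open>x * (m - m') = (s - s') * m'\<close>: one solution if \<open>m \<noteq> m'\<close>, nonzero
  exactly when \<open>s \<noteq> s'\<close>; all or no \<open>x\<close> if \<open>m = m'\<close>.
  The four-term form lets the norm of \<open>fibre_sum\<close> split into four simpler inner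
  products.\<close>

lemma count_fibre:
  fixes s s' m m' :: "'p mod_ring"
  assumes "m \<noteq> 0" "m' \<noteq> 0"
  shows "(\<Sum>x\<in>UNIV. \<Sum>x'\<in>UNIV. of_bool ((x + s, x * m) = (x' + s', x' * m'))
      * (of_bool (x \<noteq> 0) * of_bool (x' \<noteq> 0)))
       = (1::complex) - of_bool (s = s') - of_bool (m = m') + of_nat CARD('p)
           * of_bool ((s, m) = (s', m'))"
proof -
  have "(\<Sum>x\<in>UNIV. \<Sum>x'\<in>UNIV. of_bool ((x + s, x * m) = (x' + s', x' * m'))
      * (of_bool (x \<noteq> 0) * of_bool (x' \<noteq> 0)))
     = (\<Sum>x\<in>UNIV. \<Sum>x'\<in>UNIV. if x' = x + s - s' then of_bool (x * m = x' * m' \<and> x \<noteq> 0 \<and> x' \<noteq> 0)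
         else (0::complex))"
    by (intro sum.cong refl) (auto simp: algebra_simps)
  also have "\<dots> = (\<Sum>x\<in>UNIV. of_bool (x * m = (x + s - s') * m' \<and> x \<noteq> 0))"
    unfolding sum.delta[OF finite] using assms by (intro sum.cong refl) auto
  also have "\<dots> = (1::complex) - of_bool (s = s') - of_bool (m = m') + of_nat CARD('p)
      * of_bool ((s, m) = (s', m'))"
  proof (cases "m = m'")
    case True
    then have "(\<Sum>x\<in>UNIV. of_bool (x * m = (x + s - s') * m' \<and> x \<noteq> 0))
        = (\<Sum>x\<in>UNIV. of_bool (s = s') * of_bool ((x::'p mod_ring) \<noteq> 0) :: complex)"
      using assms by (intro sum.cong refl) (auto simp: algebra_simps)
    then show ?thesis using True by (simp add: sum_distrib_left[symmetric] sum_of_bool_nonzero)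
  next
    case False
    have "(\<Sum>x\<in>UNIV. of_bool (x * m = (x + s - s') * m' \<and> x \<noteq> 0))
        = (\<Sum>x\<in>UNIV. if x = (s - s') * m' / (m - m') then of_bool (s \<noteq> s') else (0::complex))"
    proof (intro sum.cong refl)
      fix x
      have "x * m = (x + s - s') * m' \<longleftrightarrow> x * (m - m') = (s - s') * m'" by (auto simp: algebra_simps)
      also have "\<dots> \<longleftrightarrow> x = (s - s') * m' / (m - m')" using False by (simp add: nonzero_eq_divide_eq)
      finally have eq: "x * m = (x + s - s') * m' \<longleftrightarrow> x = (s - s') * m' / (m - m')" .
      show "of_bool (x * m = (x + s - s') * m' \<and> x \<noteq> 0)
          = (if x = (s - s') * m' / (m - m') then of_bool (s \<noteq> s') else (0::complex))"
        unfolding eq using False assms by auto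
    qed
    then show ?thesis using False by simp
  qed
  finally show ?thesis .
qed

text \<open>By \<open>count_fibre\<close> the norm is a combination of the squared total weight,
  which is \<open>0\<close>, the norms of the push-forwards along addition,
  \<open>p\<^sup>2 - p\<close>, and along multiplication, \<open>0\<close>, and \<open>p\<close>
  times the norm for both maps jointly.\<close>

lemma norm_fibre_sum:
  "(\<Sum>i\<in>UNIV. fibre_sum i * cnj (fibre_sum i))
     = of_nat CARD('p) * (of_nat CARD('p) - 1) * (of_nat CARD('p) - 3)"
proof -
  let ?p = "of_nat CARD('p) :: complex"
  let ?s = "\<lambda>q :: 'p mod_ring \<times> 'p mod_ring. fst q + snd q"
  let ?m = "\<lambda>q :: 'p mod_ring \<times> 'p mod_ring. fst q * snd q"
  let ?same = "\<lambda>x q x' q'. of_bool ((x + ?s q, x * ?m q) = (x' + ?s q', x' * ?m q')) :: complex"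
  have "(\<Sum>i\<in>UNIV. fibre_sum i * cnj (fibre_sum i))
      = (\<Sum>x\<in>UNIV. \<Sum>q\<in>UNIV. \<Sum>x'\<in>UNIV. \<Sum>q'\<in>UNIV. ?same x q x' q'
           * ((of_bool (x \<noteq> 0) * twist q) * cnj (of_bool (x' \<noteq> 0) * twist q')))"
    unfolding fibre_sum_def sum_norm_fibres[symmetric]
    by (simp add: sum_UNIV_pair[where ?'a = "'p mod_ring" and ?'b = "'p mod_ring \<times> 'p mod_ring"])
  also have "\<dots> = (\<Sum>q\<in>UNIV. \<Sum>q'\<in>UNIV. \<Sum>x\<in>UNIV. \<Sum>x'\<in>UNIV. ?same x q x' q'
           * ((of_bool (x \<noteq> 0) * twist q) * cnj (of_bool (x' \<noteq> 0) * twist q')))"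
    by (subst sum.swap) (intro sum.cong refl trans[OF sum.cong[OF refl sum.swap] sum.swap])
  also have "\<dots> = (\<Sum>q\<in>UNIV. \<Sum>q'\<in>UNIV. twist q * cnj (twist q')
      - of_bool (?s q = ?s q') * (twist q * cnj (twist q'))
      - of_bool (?m q = ?m q') * (twist q * cnj (twist q'))
      + ?p * (of_bool ((?s q, ?m q) = (?s q', ?m q')) * (twist q * cnj (twist q'))))"
  proof (intro sum.cong refl)
    fix q q'
    have "(\<Sum>x\<in>UNIV. \<Sum>x'\<in>UNIV. ?same x q x' q'
           * ((of_bool (x \<noteq> 0) * twist q) * cnj (of_bool (x' \<noteq> 0) * twist q')))
        = (\<Sum>x\<in>UNIV. \<Sum>x'\<in>UNIV. ?same x q x' q' * (of_bool (x \<noteq> 0) * of_bool (x' \<noteq> 0)))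
           * (twist q * cnj (twist q'))" (is "?l = _")
      unfolding sum_distrib_right by (intro sum.cong refl) (simp add: of_bool_def)
    also have "\<dots> = (1 - of_bool (?s q = ?s q') - of_bool (?m q = ?m q')
        + ?p * of_bool ((?s q, ?m q) = (?s q', ?m q'))) * (twist q * cnj (twist q'))"
    \<comment> \<open>\<open>count_fibre\<close> concerns nonzero products only; for the other pairs
      the weight itself vanishes.\<close>
    proof (cases "twist q * cnj (twist q') = 0")
      case False
      then have "?m q \<noteq> 0" "?m q' \<noteq> 0" by (auto simp: twist_def omega_simps)
      then show ?thesis by (simp only: count_fibre not_False_eq_True)
    qed (simp only: mult_zero_right)
    finally show "?l = twist q * cnj (twist q')
        - of_bool (?s q = ?s q') * (twist q * cnj (twist q'))
        - of_bool (?m q = ?m q') * (twist q * cnj (twist q'))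
        + ?p * (of_bool ((?s q, ?m q) = (?s q', ?m q')) * (twist q * cnj (twist q')))"
      by (simp only: algebra_simps mult_1_left)
  qed
  also have "\<dots> = (\<Sum>q\<in>UNIV. twist q) * cnj (\<Sum>q\<in>UNIV. twist q)
      - (\<Sum>q\<in>UNIV. \<Sum>q'\<in>UNIV. of_bool (?s q = ?s q') * (twist q * cnj (twist q')))
      - (\<Sum>q\<in>UNIV. \<Sum>q'\<in>UNIV. of_bool (?m q = ?m q') * (twist q * cnj (twist q')))
      + ?p * (\<Sum>q\<in>UNIV. \<Sum>q'\<in>UNIV. of_bool ((?s q, ?m q) = (?s q', ?m q')) * (twist q * cnj (twist q')))"
    unfolding sum_product cnj_sum by (simp only: sum.distrib sum_subtractf sum_distrib_left)
  also have "\<dots> = - (\<Sum>a\<in>UNIV. (?p * of_bool (a = (0::'p mod_ring)) - 1)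
      * cnj (?p * of_bool (a = 0) - 1)) + ?p * ((?p - 1) * (?p - 2))"
    unfolding norm_sum_twist_add_mult sum_twist sum_norm_fibres[of ?s] sum_norm_fibres[of ?m]
      sum_twist_add sum_twist_mult
    by simp
  also have "(\<Sum>a\<in>UNIV. (?p * of_bool (a = (0::'p mod_ring)) - 1) * cnj (?p * of_bool (a = 0) - 1))
      = (\<Sum>a\<in>UNIV. (if a = (0::'p mod_ring) then ?p\<^sup>2 - 2 * ?p else 0) + 1)"
    by (intro sum.cong refl) (auto simp: power2_eq_square algebra_simps)
  also have "\<dots> = ?p\<^sup>2 - ?p" by (simp add: sum.distrib)
  finally show ?thesis by (simp add: algebra_simps power2_eq_square)
qed

text \<open>
  The fibre over \<open>(3 e, e\<^sup>3)\<close> is a cubic with a node at \<open>(e, e, e)\<close>. The parameter \<open>v\<close> is the slope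
  of a line through the node; \<open>\<zeta>\<close> and \<open>-1 - \<zeta>\<close> are the slopes of the two tangents there.
\<close>

lemma fibre_sum_nodal:
  assumes e: "e \<noteq> 0"
  shows "fibre_sum (3 * e, e ^ 3) = of_nat CARD('p) - 3"
proof -
  \<comment> \<open>The lines of slope \<open>0\<close> and \<open>-1\<close> meet the cubic in no
    affine point but the node, and so do the two tangents. The remaining \<open>p - 4\<close> slopes
    give one further point each, so the fibre has \<open>p - 3\<close> points with the node.\<close>
  define V where "V = - {0, -1, \<zeta>, -1 - \<zeta>}"
  define D where "D v = e * (1 + v + v\<^sup>2) / (v * (1 + v))" for v
  define T where "T v = (e + (1 + v) * D v, e - v * D v, e - D v)" for v
  define S where "S = {w. sum_prod w = (3 * e, e ^ 3)}"
  have V_iff: "v \<in> V \<longleftrightarrow> v \<noteq> 0 \<and> 1 + v \<noteq> 0 \<and> 1 + v + v\<^sup>2 \<noteq> 0" for v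
  proof -
    have fac: "1 + v + v\<^sup>2 = (v - \<zeta>) * (v - (-1 - \<zeta>)) + (\<zeta>\<^sup>2 + \<zeta> + 1)"
      by (simp add: algebra_simps power2_eq_square)
    have "1 + v + v\<^sup>2 = 0 \<longleftrightarrow> v = \<zeta> \<or> v = -1 - \<zeta>"
      unfolding fac zeta by (simp only: add_0_right mult_eq_0_iff right_minus_eq)
    moreover have "1 + v = 0 \<longleftrightarrow> v = -1" by (metis add_eq_0_iff minus_minus)
    ultimately show ?thesis unfolding V_def by auto
  qed
  have zeta0: "\<zeta> \<noteq> 0" "\<zeta> \<noteq> -1" using zeta by auto
  \<comment> \<open>The discriminant of \<open>X\<^sup>2 + X + 1\<close> is \<open>-3\<close>, so
    the tangents are distinct because \<open>3 \<noteq> 0\<close>.\<close>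
  have zeta1: "\<zeta> \<noteq> -1 - \<zeta>"
  proof
    assume "\<zeta> = -1 - \<zeta>"
    then have "2 * \<zeta> + 1 = 0" by (simp add: algebra_simps)
    moreover have "3 = 4 * (\<zeta>\<^sup>2 + \<zeta> + 1) - (2 * \<zeta> + 1) * (2 * \<zeta> + 1)"
      by (simp add: algebra_simps power2_eq_square)
    ultimately show False using three_neq_0 zeta by simp
  qed
  have "card {0, -1, \<zeta>, -1 - \<zeta>} = 4"
    using zeta0 zeta1 by (auto simp: card_insert_if eq_diff_eq)
  then have cV: "(of_nat (card V) :: complex) = of_nat CARD('p) - 4"
    using card_mono[of UNIV "{0, -1, \<zeta>, -1 - \<zeta>}"]
    by (simp add: V_def card_Diff_subset Compl_eq_Diff_UNIV of_nat_diff)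
  have D0: "D v \<noteq> 0" "v * (1 + v) * D v = e * (1 + v + v\<^sup>2)" if "v \<in> V" for v
    using that e by (auto simp: V_iff D_def)
  have injT: "inj_on T V"
  proof (rule inj_onI)
    fix v v' assume v: "v \<in> V" "v' \<in> V" "T v = T v'"
    then have "D v = D v'" "v * D v = v' * D v'" by (auto simp: T_def)
    then show "v = v'" using D0(1)[OF v(2)] by simp
  qed
  have sub: "T v \<in> S" if "v \<in> V" for v
  proof -
    have "(e + (1 + v) * D v) * ((e - v * D v) * (e - D v)) - e ^ 3
       = (D v)\<^sup>2 * (v * (1 + v) * D v - e * (1 + v + v\<^sup>2))"
      by (simp add: algebra_simps power2_eq_square power3_eq_cube)
    then have "(e + (1 + v) * D v) * ((e - v * D v) * (e - D v)) = e ^ 3"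
      using D0(2)[OF that] by simp
    then show ?thesis unfolding S_def T_def by (simp add: algebra_simps)
  qed
  have sup: "w \<in> insert (e, e, e) (T ` V)" if w: "w \<in> S" for w
  proof -
    obtain x y z where xyz: "w = (x, y, z)" by (cases w)
    have s: "x + y + z = 3 * e" "x * y * z = e ^ 3"
      using w by (auto simp: xyz S_def mult.assoc add.assoc)
    \<comment> \<open>If one coordinate is \<open>e\<close>, the others have sum
      \<open>2 * e\<close> and product \<open>e\<^sup>2\<close>, hence both are \<open>e\<close>.
      Away from the node, therefore, no coordinate is \<open>e\<close>, and the slope is defined and
      differs from \<open>0\<close> and \<open>-1\<close>.\<close>
    have two: "a = e \<and> b = e" if "a + b = 2 * e" "a * b * e = e ^ 3" for a b :: "'p mod_ring"
    proof -
      have b: "b = 2 * e - a" using that(1) by (simp add: algebra_simps)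
      have "e * (a - e) ^ 2 = e ^ 3 - a * b * e" unfolding b
        by (simp add: algebra_simps power2_eq_square power3_eq_cube)
      then have "(a - e) ^ 2 = 0" using that e by simp
      then show ?thesis using b by simp
    qed
    show ?thesis
    proof (cases "x = e \<or> y = e \<or> z = e")
      case True
      then have "x = e \<and> y = e \<and> z = e"
        using two[of y z] two[of x z] two[of x y] s by (auto simp: algebra_simps)
      then show ?thesis by (simp add: xyz)
    next
      case False
      define d v where "d = e - z" and "v = (e - y) / (e - z)"
      have d: "d \<noteq> 0" using False by (auto simp: d_def)
      have y: "y = e - v * d" using False by (auto simp: d_def v_def)
      have z: "z = e - d" by (simp add: d_def)
      have x: "x = e + (1 + v) * d" using s(1) unfolding y z by (simp add: algebra_simps)
      have "v \<noteq> 0" using False y by auto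
      moreover have "1 + v \<noteq> 0" using False x by auto
      moreover have "d\<^sup>2 * (v * (1 + v) * d - e * (1 + v + v\<^sup>2)) = x * y * z - e ^ 3"
        unfolding x y z by (simp add: algebra_simps power2_eq_square power3_eq_cube)
      then have eq: "v * (1 + v) * d = e * (1 + v + v\<^sup>2)" using s d by simp
      ultimately have "v \<in> V" using d e by (auto simp: V_iff)
      moreover have "d = D v"
        unfolding D_def using eq \<open>v \<noteq> 0\<close> \<open>1 + v \<noteq> 0\<close> by (simp add: nonzero_eq_divide_eq mult.commute)
      ultimately show ?thesis unfolding xyz T_def using x y z by auto
    qed
  qed
  have S_eq: "S = insert (e, e, e) (T ` V)"
    using sup sub by (auto simp: S_def power3_eq_cube)
  have "fibre_sum (3 * e, e ^ 3) = (\<Sum>w\<in>S. of_bool (fst w \<noteq> 0) * twist (snd w))"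
    unfolding fibre_sum_def S_def by (rule sum.mono_neutral_cong_right) auto
  also have "\<dots> = (\<Sum>w\<in>S. 1)"
  proof (rule sum.cong[OF refl])
    fix w assume w: "w \<in> S"
    have nz: "fst w \<noteq> 0" using w e unfolding S_def by (intro notI) simp
    have "twist (snd w) = 1"
    proof (cases "w = (e, e, e)")
      case True
      then show ?thesis using e by (simp add: twist_eq omega_simps)
    next
      case False
      then obtain v where v: "v \<in> V" "w = T v" using w S_eq by auto
      \<comment> \<open>On the cubic this identity reads \<open>y = v\<^sup>3 * z\<close>: the ratio
        is a cube, so \<open>\<omega>\<close> takes the value \<open>1\<close> on it.\<close>
      have "(v ^ 3 * (e - D v) - (e - v * D v)) = (v - 1) * (e * (1 + v + v\<^sup>2) - v * (1 + v) * D v)"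
        by (simp add: algebra_simps power2_eq_square power3_eq_cube)
      then have "e - v * D v = v ^ 3 * (e - D v)" using D0(2)[OF v(1)] by simp
      moreover have "e - D v \<noteq> 0" using w v(2) e unfolding S_def by (intro notI) (simp add: T_def)
      ultimately have "twist (snd w) = \<omega> v ^ 3"
        unfolding v(2) T_def by (simp add: twist_eq omega_simps)
      then show ?thesis using omega_cube[of v] v(1) by (simp add: V_iff)
    qed
    then show "of_bool (fst w \<noteq> 0) * twist (snd w) = 1" using nz by simp
  qed
  also have "\<dots> = 1 + of_nat (card V)"
  proof -
    have "(e, e, e) \<notin> T ` V" using D0(1) by (auto simp: T_def)
    then show ?thesis unfolding S_eq by (simp add: card_image[OF injT])
  qed
  finally show ?thesis using cV by simp
qed

section \<open>The counting measure of the curve \<open>(3 e, e\<^sup>3)\<close>\<close>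

text \<open>The subtracted \<open>1\<close> counts the nonzero cube roots of the second coordinate.
  It makes the sum over the first coordinate vanish, as it does for \<open>fibre_sum\<close> over
  nonzero products.\<close>

definition fibre_delta :: "'p mod_ring \<times> 'p mod_ring \<Rightarrow> complex" where
  "fibre_delta i = (\<Sum>e\<in>UNIV. of_bool (e \<noteq> 0 \<and> e ^ 3 = snd i)
      * (of_nat CARD('p) * of_bool (3 * e = fst i) - 1))"

lemma cnj_delta: "cnj (fibre_delta i) = fibre_delta i"
  unfolding fibre_delta_def cnj_sum by (intro sum.cong refl) (simp add: of_bool_def)

lemma sum_delta:
  fixes G :: "'p mod_ring \<times> 'p mod_ring \<Rightarrow> complex"
  shows "(\<Sum>i\<in>UNIV. fibre_delta i * G i)
    = (\<Sum>e\<in>UNIV. of_bool (e \<noteq> 0) * (of_nat CARD('p) * G (3 * e, e ^ 3) - (\<Sum>a\<in>UNIV. G (a, e ^ 3))))"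
proof -
  have "(\<Sum>i\<in>UNIV. fibre_delta i * G i)
      = (\<Sum>e\<in>UNIV. \<Sum>i\<in>UNIV. of_bool (e \<noteq> 0 \<and> e ^ 3 = snd i)
          * (of_nat CARD('p) * of_bool (3 * e = fst i) - 1) * G i)"
    unfolding fibre_delta_def sum_distrib_right by (rule sum.swap)
  also have "\<dots> = (\<Sum>e\<in>UNIV. of_bool (e \<noteq> 0)
      * (of_nat CARD('p) * G (3 * e, e ^ 3) - (\<Sum>a\<in>UNIV. G (a, e ^ 3))))"
  proof (intro sum.cong refl)
    fix e :: "'p mod_ring"
    have "(\<Sum>i\<in>UNIV. of_bool (e \<noteq> 0 \<and> e ^ 3 = snd i) * (of_nat CARD('p) * of_bool (3 * e = fst i) - 1)
        * G i)
      = (\<Sum>a\<in>UNIV. \<Sum>b\<in>UNIV. if b = e ^ 3 then of_bool (e \<noteq> 0)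
          * (of_nat CARD('p) * of_bool (3 * e = a) - 1) * G (a, b) else 0)"
      unfolding sum_UNIV_pair by (intro sum.cong refl) auto
    also have "\<dots> = (\<Sum>a\<in>UNIV. of_bool (e \<noteq> 0)
        * ((if a = 3 * e then of_nat CARD('p) * G (a, e ^ 3) else 0) - G (a, e ^ 3)))"
      unfolding sum.delta[OF finite] by (intro sum.cong refl) (auto simp: algebra_simps)
    also have "\<dots> = of_bool (e \<noteq> 0) * (of_nat CARD('p) * G (3 * e, e ^ 3) - (\<Sum>a\<in>UNIV. G (a, e ^ 3)))"
      unfolding sum_distrib_left[symmetric] by (simp add: sum_subtractf)
    finally show "(\<Sum>i\<in>UNIV. of_bool (e \<noteq> 0 \<and> e ^ 3 = snd i)
        * (of_nat CARD('p) * of_bool (3 * e = fst i) - 1) * G i)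
      = of_bool (e \<noteq> 0) * (of_nat CARD('p) * G (3 * e, e ^ 3) - (\<Sum>a\<in>UNIV. G (a, e ^ 3)))" .
  qed
  finally show ?thesis .
qed

text \<open>Pairing with \<open>fibre_delta\<close> sees only the values on the curve and the sums
  over the first coordinate. Stated for a general \<open>G\<close> so that it applies to
  \<open>fibre_sum\<close> and to \<open>fibre_delta\<close> itself.\<close>

lemma sum_delta_nodal:
  fixes G :: "'p mod_ring \<times> 'p mod_ring \<Rightarrow> complex"
  assumes "\<And>e. e \<noteq> 0 \<Longrightarrow> G (3 * e, e ^ 3) = of_nat CARD('p) - 3" "\<And>b. b \<noteq> 0 \<Longrightarrow> (\<Sum>a\<in>UNIV. G (a, b)) = 0"
  shows "(\<Sum>i\<in>UNIV. fibre_delta i * G i)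
      = of_nat CARD('p) * (of_nat CARD('p) - 1) * (of_nat CARD('p) - 3)"
proof -
  have "(\<Sum>i\<in>UNIV. fibre_delta i * G i)
      = (\<Sum>e\<in>UNIV. of_bool ((e::'p mod_ring) \<noteq> 0) * (of_nat CARD('p) * (of_nat CARD('p) - 3)))"
    unfolding sum_delta
  proof (intro sum.cong refl)
    fix e :: "'p mod_ring"
    show "of_bool (e \<noteq> 0) * (of_nat CARD('p) * G (3 * e, e ^ 3) - (\<Sum>a\<in>UNIV. G (a, e ^ 3)))
        = of_bool (e \<noteq> 0) * (of_nat CARD('p) * (of_nat CARD('p) - 3))"
      by (cases "e = 0") (simp_all add: assms)
  qed
  then show ?thesis unfolding sum_distrib_right[symmetric] sum_of_bool_nonzero
      by (simp add: algebra_simps)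
qed

text \<open>For \<open>y * z \<noteq> 0\<close> exactly one \<open>x\<close> makes the product equal
  to \<open>b\<close>, so what remains is the total weight of \<open>twist\<close>, which is
  zero.\<close>

lemma sum_fibre_sum:
  assumes "b \<noteq> 0"
  shows "(\<Sum>a\<in>UNIV. fibre_sum (a, b)) = 0"
proof -
  have "(\<Sum>a\<in>UNIV. fibre_sum (a, b)) = (\<Sum>w\<in>UNIV. \<Sum>a\<in>UNIV. of_bool (sum_prod w = (a, b))
            * (of_bool (fst w \<noteq> 0) * twist (snd w)))"
    unfolding fibre_sum_def by (rule sum.swap)
  also have "\<dots> = (\<Sum>w\<in>UNIV. \<Sum>a\<in>UNIV. if a
      = fst w + (fst (snd w) + snd (snd w)) then of_bool (fst w * (fst (snd w) * snd (snd w)) = b)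
            * (of_bool (fst w \<noteq> 0) * twist (snd w)) else 0)"
    by (intro sum.cong refl) auto
  also have "\<dots> = (\<Sum>q\<in>UNIV. \<Sum>x\<in>UNIV. of_bool (x * (fst q * snd q) = b) * (of_bool (x \<noteq> 0) * twist q))"
    unfolding sum_UNIV_pair[where ?'a = "'p mod_ring" and ?'b = "'p mod_ring \<times> 'p mod_ring"]
    by (subst sum.swap) simp
  also have "\<dots> = (\<Sum>q\<in>UNIV. twist q)"
  proof (intro sum.cong refl)
    fix q
    show "(\<Sum>x\<in>UNIV. of_bool (x * (fst q * snd q) = b) * (of_bool (x \<noteq> 0) * twist q)) = twist q"
    proof (cases "fst q * snd q = 0")
      case True
      then show ?thesis using assms by (auto simp: twist_def omega_simps)
    next
      case False
      have "(\<Sum>x\<in>UNIV. of_bool (x * (fst q * snd q) = b) * (of_bool (x \<noteq> 0) * twist q))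
          = (\<Sum>x\<in>UNIV. if x = b / (fst q * snd q) then twist q else 0)"
        using False assms by (intro sum.cong refl) (auto simp: nonzero_eq_divide_eq)
      then show ?thesis by simp
    qed
  qed
  finally show ?thesis by (simp add: sum_twist)
qed

lemma sum_delta_fst: "(\<Sum>a\<in>UNIV. fibre_delta (a, b)) = 0"
proof -
  have "(\<Sum>a\<in>UNIV. fibre_delta (a, b))
      = (\<Sum>e\<in>UNIV. \<Sum>a\<in>UNIV. of_bool (e \<noteq> 0 \<and> e ^ 3 = b)
          * ((if a = 3 * e then of_nat CARD('p) else 0) - 1))"
    unfolding fibre_delta_def by (subst sum.swap) (intro sum.cong refl, auto)
  also have "\<dots> = 0"
    unfolding sum_distrib_left[symmetric] by (simp add: sum_subtractf)
  finally show ?thesis .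
qed

text \<open>The cube roots of \<open>e ^ 3\<close> are \<open>e\<close>, \<open>\<zeta> * e\<close>
  and \<open>\<zeta>\<^sup>2 * e\<close>. Each contributes \<open>-1\<close>, and only
  \<open>e\<close> has the triple \<open>3 * e\<close>, which adds \<open>p\<close>.\<close>

lemma delta_nodal:
  assumes e: "e \<noteq> 0"
  shows "fibre_delta (3 * e, e ^ 3) = of_nat CARD('p) - 3"
proof -
  have zeta0: "\<zeta> \<noteq> 0" "\<zeta> \<noteq> 1" using zeta three_neq_0 by auto
  have z3: "\<zeta> ^ 3 = 1"
  proof -
    have "\<zeta> ^ 3 - 1 = (\<zeta> - 1) * (\<zeta>\<^sup>2 + \<zeta> + 1)"
      by (simp add: algebra_simps power2_eq_square power3_eq_cube)
    then show ?thesis using zeta by simp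
  qed
  have roots: "{e'. e' \<noteq> 0 \<and> e' ^ 3 = e ^ 3} = {e, \<zeta> * e, \<zeta>\<^sup>2 * e}"
  proof -
    have "e' \<noteq> 0 \<and> e' ^ 3 = e ^ 3 \<longleftrightarrow> e' \<in> {e, \<zeta> * e, \<zeta>\<^sup>2 * e}" for e'
    proof -
      have "(e' - e) * ((e' - \<zeta> * e) * (e' - \<zeta>\<^sup>2 * e))
          = e' ^ 3 - \<zeta> ^ 3 * e ^ 3 - (\<zeta>\<^sup>2 + \<zeta> + 1) * e' * e * (e' - \<zeta> * e)"
        by (simp add: algebra_simps power2_eq_square power3_eq_cube)
      then have "e' ^ 3 = e ^ 3 \<longleftrightarrow> e' \<in> {e, \<zeta> * e, \<zeta>\<^sup>2 * e}" using z3 zeta by auto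
      then show ?thesis using e zeta0 by auto
    qed
    then show ?thesis by blast
  qed
  have z2: "\<zeta>\<^sup>2 \<noteq> 1" using z3 zeta0 by (auto simp: power2_eq_square power3_eq_cube)
  have "card {e, \<zeta> * e, \<zeta>\<^sup>2 * e} = 3"
    using zeta0 z2 e by (auto simp: card_insert_if power2_eq_square)
  have "fibre_delta (3 * e, e ^ 3) = (\<Sum>e'\<in>{e'. e' \<noteq> 0 \<and> e' ^ 3
      = e ^ 3}. (if e' = e then of_nat CARD('p) else 0) - 1)"
    unfolding fibre_delta_def using three_neq_0 by (intro sum.mono_neutral_cong_right) auto
  also have "\<dots> = of_nat CARD('p) - of_nat (card {e'. e' \<noteq> 0 \<and> e' ^ 3 = e ^ 3})"
    using e by (simp add: sum_subtractf)
  finally show ?thesis using \<open>card _ = 3\<close> by (simp only: roots) simp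
qed

text \<open>Equality case of the Cauchy-Schwarz inequality.\<close>

lemma fibre_sum_eq_delta: "fibre_sum = fibre_delta"
proof -
  have Ku: "(\<Sum>i\<in>UNIV. fibre_delta i * fibre_sum i)
      = of_nat CARD('p) * (of_nat CARD('p) - 1) * (of_nat CARD('p) - 3)"
    by (rule sum_delta_nodal) (simp_all add: fibre_sum_nodal sum_fibre_sum)
  then have "cnj (\<Sum>i\<in>UNIV. fibre_delta i * fibre_sum i)
      = of_nat CARD('p) * (of_nat CARD('p) - 1) * (of_nat CARD('p) - 3)"
    by simp
  then have uK: "(\<Sum>i\<in>UNIV. fibre_delta i * cnj (fibre_sum i))
      = of_nat CARD('p) * (of_nat CARD('p) - 1) * (of_nat CARD('p) - 3)"
    by (simp add: cnj_delta)
  have uu: "(\<Sum>i\<in>UNIV. fibre_delta i * fibre_delta i)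
      = of_nat CARD('p) * (of_nat CARD('p) - 1) * (of_nat CARD('p) - 3)"
    by (rule sum_delta_nodal) (simp_all add: delta_nodal sum_delta_fst)
  \<comment> \<open>All four inner products in the expansion have the value
    \<open>p * (p - 1) * (p - 3)\<close>, with signs \<open>+ - - +\<close>.\<close>
  have "complex_of_real (\<Sum>i\<in>UNIV. (norm (fibre_sum i - fibre_delta i))\<^sup>2)
      = (\<Sum>i\<in>UNIV. (fibre_sum i - fibre_delta i) * cnj (fibre_sum i - fibre_delta i))"
    by (simp only: of_real_sum complex_norm_square)
  also have "\<dots> = (\<Sum>i\<in>UNIV. fibre_sum i * cnj (fibre_sum i) - fibre_delta i * fibre_sum i - fibre_delta i
      * cnj (fibre_sum i) + fibre_delta i * fibre_delta i)"
    by (intro sum.cong refl) (simp add: cnj_delta algebra_simps)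
  also have "\<dots> = 0" by (simp only: sum.distrib sum_subtractf norm_fibre_sum Ku uK uu) simp
  finally have "(\<Sum>i\<in>UNIV. (norm (fibre_sum i - fibre_delta i))\<^sup>2) = 0" by (simp only: of_real_eq_0_iff)
  then have "\<forall>i. (norm (fibre_sum i - fibre_delta i))\<^sup>2 = 0"
    by (subst (asm) sum_nonneg_eq_0_iff) auto
  then show ?thesis by (auto simp: fun_eq_iff)
qed

text \<open>The equality \<open>fibre_sum = fibre_delta\<close> tested against \<open>h\<close>,
  completed by the triples with \<open>x = 0\<close>.\<close>

theorem cubic_sum_identity:
  "(\<Sum>x\<in>UNIV. \<Sum>y\<in>UNIV. \<Sum>z\<in>UNIV. \<omega> y * cnj (\<omega> z) * h (x + y + z) (x * y * z))
    = of_nat CARD('p) * (\<Sum>e\<in>UNIV. h (3 * e) (e ^ 3)) - (\<Sum>e\<in>UNIV. \<Sum>a\<in>UNIV. h a (e ^ 3))"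
proof -
  define g where "g i = h (fst i) (snd i)" for i
  have "(\<Sum>x\<in>UNIV. \<Sum>y\<in>UNIV. \<Sum>z\<in>UNIV. \<omega> y * cnj (\<omega> z) * h (x + y + z) (x * y * z))
     = (\<Sum>x\<in>UNIV. \<Sum>q\<in>UNIV. twist q * g (x + (fst q + snd q), x * (fst q * snd q)))"
    by (simp add: sum_UNIV_pair twist_def g_def ac_simps)
  also have "\<dots> = (\<Sum>x\<in>UNIV. \<Sum>q\<in>UNIV. of_bool (x \<noteq> 0) * twist q
      * g (x + (fst q + snd q), x * (fst q * snd q)))
       + (\<Sum>x\<in>(UNIV::'p mod_ring set). if x = 0 then \<Sum>q\<in>UNIV. twist q * g (fst q + snd q, 0) else 0)"
    unfolding sum.distrib[symmetric] by (intro sum.cong refl) auto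
  also have "(\<Sum>x\<in>UNIV. \<Sum>q\<in>UNIV. of_bool (x \<noteq> 0) * twist q * g (x + (fst q + snd q), x * (fst q * snd q)))
     = (\<Sum>i\<in>UNIV. fibre_sum i * g i)"
    unfolding fibre_sum_def sum_fibres
        by (simp add: sum_UNIV_pair[where ?'a = "'p mod_ring" and ?'b = "'p mod_ring \<times> 'p mod_ring"])
  also have "\<dots> = (\<Sum>e\<in>UNIV. of_bool (e \<noteq> 0)
      * (of_nat CARD('p) * g (3 * e, e ^ 3) - (\<Sum>a\<in>UNIV. g (a, e ^ 3))))"
    unfolding fibre_sum_eq_delta sum_delta ..
  \<comment> \<open>By \<open>sum_twist_add\<close> the plane \<open>x = 0\<close> yields precisely
    the summand \<open>e = 0\<close> that \<open>fibre_delta\<close> leaves out.\<close>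
  also have "(\<Sum>x\<in>(UNIV::'p mod_ring set). if x = 0 then \<Sum>q\<in>UNIV. twist q * g (fst q + snd q, 0) else 0)
     = (\<Sum>a\<in>UNIV. (\<Sum>q\<in>UNIV. of_bool (fst q + snd q = a) * twist q) * g (a, 0))"
    unfolding sum_fibres by simp
  also have "\<dots> = (\<Sum>a\<in>UNIV. (if a = 0 then of_nat CARD('p) * g (a, 0) else 0) - g (a, 0))"
    unfolding sum_twist_add by (intro sum.cong refl) (auto simp: algebra_simps)
  also have "\<dots> = (\<Sum>e\<in>UNIV. if e = 0 then of_nat CARD('p) * g (3 * e, e ^ 3) - (\<Sum>a\<in>UNIV. g (a, e ^ 3))
      else 0)"
    by (simp add: sum_subtractf)
  also have "(\<Sum>e\<in>UNIV. of_bool (e \<noteq> 0) * (of_nat CARD('p) * g (3 * e, e ^ 3) - (\<Sum>a\<in>UNIV. g (a, e ^ 3))))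
      + \<dots>
     = (\<Sum>e\<in>UNIV. of_nat CARD('p) * g (3 * e, e ^ 3) - (\<Sum>a\<in>UNIV. g (a, e ^ 3)))"
    unfolding sum.distrib[symmetric] by (intro sum.cong refl) auto
  finally show ?thesis by (simp add: sum_subtractf sum_distrib_left g_def)
qed

end

section \<open>Greene's function as a character sum in one variable\<close>

text \<open>After expanding both binomials, \<open>\<chi>\<close> is evaluated at a single quotient,
  and orthogonality forces that quotient to be \<open>1\<close>. For fixed \<open>y\<close> this is
  a linear equation for \<open>x\<close>. The factors \<open>p\<close>, \<open>p / (p - 1)\<close>,
  \<open>p - 1\<close> and \<open>1 / p\<^sup>2\<close> cancel.\<close>

lemma greene_2F1_triv_eq_sum:
  fixes A B :: "'p::prime_card mod_ring \<Rightarrow> complex"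
  assumes A: "A \<in> mult_chars" and B: "B \<in> mult_chars" and t: "t \<noteq> 0"
  shows "of_nat CARD('p) * greene_2F1 A B triv_char t
       = (\<Sum>y\<in>UNIV. B y * A (1 - y) * cnj (A (1 - (1 - t) * y)))"
proof -
  let ?p = "of_nat CARD('p) :: complex"
  have p: "?p \<noteq> 0" "?p - 1 \<noteq> 0"
    using nontriv[where ?'a='p] by auto
  have step: "char_binom (char_mult A \<chi>) \<chi> * char_binom (char_mult B \<chi>) (char_mult triv_char \<chi>) * \<chi> t
      = (\<Sum>x\<in>UNIV. \<Sum>y\<in>UNIV. A x * B y * \<chi> (t * (x * y) / ((1 - x) * (1 - y)))) / ?p\<^sup>2"
    if chi: "\<chi> \<in> mult_chars" for \<chi>
  proof -
    have tr: "char_mult triv_char \<chi> = \<chi>"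
      using mult_char_0[OF chi] by (auto simp: char_mult_def triv_char_def)
    have "\<chi> (-1) * \<chi> (-1) = 1"
      using mult_char_mult[OF chi, of "-1" "-1"] mult_char_1[OF chi] by simp
    then have "char_binom (char_mult A \<chi>) \<chi> * char_binom (char_mult B \<chi>) \<chi> * \<chi> t
       = (\<Sum>x\<in>UNIV. A x * \<chi> x * cnj (\<chi> (1 - x))) * (\<Sum>y\<in>UNIV. B y * \<chi> y * cnj (\<chi> (1 - y))) * \<chi> t / ?p\<^sup>2"
      unfolding char_binom_def char_mult_def by (simp add: power2_eq_square)
    also have "(\<Sum>x\<in>UNIV. A x * \<chi> x * cnj (\<chi> (1 - x))) * (\<Sum>y\<in>UNIV. B y * \<chi> y * cnj (\<chi> (1 - y))) * \<chi> t
      = (\<Sum>x\<in>UNIV. \<Sum>y\<in>UNIV. A x * B y * \<chi> (t * (x * y) / ((1 - x) * (1 - y))))"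
      unfolding sum_product unfolding sum_distrib_right
      by (intro sum.cong refl)
         (simp add: mult_char_mult[OF chi] mult_char_inverse[OF chi] cnj_mult_char[OF chi]
             divide_inverse)
    finally show ?thesis unfolding tr .
  qed
  have "of_nat CARD('p) * greene_2F1 A B triv_char t =
    ?p * (?p / (?p - 1)) * (\<Sum>\<chi>\<in>mult_chars. (\<Sum>x\<in>UNIV. \<Sum>y\<in>UNIV. A x * B y
        * \<chi> (t * (x * y) / ((1 - x) * (1 - y)))) / ?p\<^sup>2)"
    unfolding greene_2F1_def by (simp add: step cong: sum.cong)
  also have "(\<Sum>\<chi>\<in>mult_chars. (\<Sum>x\<in>UNIV. \<Sum>y\<in>UNIV. A x * B y
      * \<chi> (t * (x * y) / ((1 - x) * (1 - y)))) / ?p\<^sup>2)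
     = (\<Sum>y\<in>UNIV. \<Sum>x\<in>UNIV. A x * B y * (\<Sum>\<chi>\<in>mult_chars. \<chi> (t * (x * y) / ((1 - x) * (1 - y))))) / ?p\<^sup>2"
    unfolding sum_divide_distrib[symmetric]
    by (subst sum.swap[of _ UNIV mult_chars], subst sum.swap[of _ UNIV mult_chars], subst sum.swap[of _
        UNIV UNIV]) (simp add: sum_distrib_left)
  also have "(\<Sum>y\<in>UNIV. \<Sum>x\<in>UNIV. A x * B y * (\<Sum>\<chi>\<in>mult_chars. \<chi> (t * (x * y) / ((1 - x) * (1 - y)))))
     = (\<Sum>y\<in>UNIV. (?p - 1) * (B y * A (1 - y) * cnj (A (1 - (1 - t) * y))))"
  proof (intro sum.cong refl)
    fix y :: "'p mod_ring"
    let ?d = "1 - (1 - t) * y"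
    show "(\<Sum>x\<in>UNIV. A x * B y * (\<Sum>\<chi>\<in>mult_chars. \<chi> (t * (x * y) / ((1 - x) * (1 - y)))))
      = (?p - 1) * (B y * A (1 - y) * cnj (A ?d))"
    proof (cases "y = 0")
      case True
      then show ?thesis by (simp add: mult_char_0[OF B])
    next
      case y: False
      have "(\<Sum>x\<in>UNIV. A x * B y * (\<Sum>\<chi>\<in>mult_chars. \<chi> (t * (x * y) / ((1 - x) * (1 - y)))))
        = (\<Sum>x\<in>UNIV. if x = (1 - y) / ?d then A x * B y * (?p - 1) else 0)"
      proof (intro sum.cong refl)
        fix x :: "'p mod_ring"
        let ?q = "t * (x * y) / ((1 - x) * (1 - y))"
        show "A x * B y * (\<Sum>\<chi>\<in>mult_chars. \<chi> ?q) = (if x = (1 - y) / ?d then A x * B y * (?p - 1) else 0)"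
        proof (cases "x = 0")
          case True
          then show ?thesis by (simp add: mult_char_0[OF A])
        next
          case x: False
          \<comment> \<open>Vanishing denominators cause no exception: they make the quotient
            \<open>0\<close> on either side, whereas \<open>1 \<noteq> 0\<close> and
            \<open>x \<noteq> 0\<close>.\<close>
          have iff: "?q = 1 \<longleftrightarrow> x = (1 - y) / ?d"
          proof -
            have "t * (x * y) - (1 - x) * (1 - y) = x * ?d - (1 - y)" by (simp add: algebra_simps)
            then have e: "t * (x * y) = (1 - x) * (1 - y) \<longleftrightarrow> x * ?d = 1 - y"
              by (metis right_minus_eq)
            show ?thesis
            proof
              assume "?q = 1"
              then have "x * ?d = 1 - y" "1 - y \<noteq> 0" using e by (auto simp: divide_eq_1_iff)
              then show "x = (1 - y) / ?d" by (metis mult_zero_right nonzero_eq_divide_eq)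
            next
              assume "x = (1 - y) / ?d"
              then have "x * ?d = 1 - y" using x by auto
              then have "t * (x * y) = (1 - x) * (1 - y)" using e by simp
              moreover have "t * (x * y) \<noteq> 0" using x y t by simp
              ultimately show "?q = 1" by simp
            qed
          qed
          show ?thesis
          proof (cases "?q = 0")
            case True
            have "(\<Sum>\<chi>\<in>mult_chars. \<chi> ?q) = 0" unfolding True by (simp add: mult_char_0)
            moreover have "x \<noteq> (1 - y) / ?d" using True iff by (metis zero_neq_one)
            ultimately show ?thesis by (simp only: if_False mult_zero_right)
          next
            case False
            then show ?thesis unfolding sum_mult_chars[OF False] iff
                by (simp only: mult_zero_right split: if_split) blast
          qed
        qed
      qed
      also have "\<dots> = (?p - 1) * (B y * A (1 - y) * cnj (A ?d))"
        by (simp add: mult_char_mult[OF A] mult_char_inverse[OF A] cnj_mult_char[OF A] divide_inverse)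
      finally show ?thesis .
    qed
  qed
  finally show ?thesis using p by (simp add: sum_distrib_left[symmetric] power2_eq_square)
qed

section \<open>Characters of order twelve\<close>

context
  fixes \<xi> :: "'p::prime_card mod_ring \<Rightarrow> complex"
  assumes xi: "\<xi> \<in> mult_chars"
    and card_mod_12: "[CARD('p) = 1] (mod 12)"
    and order_xi: "char_order \<xi> = 12"
begin

lemmas xi_simps = mult_char_0[OF xi] mult_char_1[OF xi] mult_char_mult[OF xi]
  mult_char_eq_0_iff[OF xi] mult_char_divide[OF xi] mult_char_power[OF xi]
  mult_char_inverse[OF xi] cnj_mult_char[OF xi]

lemma card_eq_12_times: obtains k where "CARD('p) = 12 * k + 1" "k > 0"
proof -
  have "CARD('p) = 12 * (CARD('p) div 12) + CARD('p) mod 12" by simp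
  moreover have "CARD('p) mod 12 = 1" using card_mod_12 by (simp add: cong_def)
  ultimately have eq: "CARD('p) = 12 * (CARD('p) div 12) + 1" by (simp only:)
  moreover have "CARD('p) div 12 > 0"
    using eq nontriv[where ?'a='p] by (metis add.left_neutral mult_0_right nat_neq_iff not_gr_zero)
  ultimately show ?thesis by (rule that)
qed

lemma card_ge_13: "CARD('p) \<ge> 13"
  by (rule card_eq_12_times) simp

lemma char_power_eq_triv_iff: "char_power \<xi> (int n) = triv_char \<longleftrightarrow> (\<forall>x. x \<noteq> 0 \<longrightarrow> \<xi> x ^ n = 1)"
  by (auto simp: char_power_def triv_char_def fun_eq_iff)

lemma xi_power_12: "x \<noteq> 0 \<Longrightarrow> \<xi> x ^ 12 = 1"
proof -
  have "\<exists>n. n > 0 \<and> char_power \<xi> (int n) = triv_char"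
    unfolding char_power_eq_triv_iff using mult_char_power_CARD[OF xi] card_ge_13
        by (intro exI[of _ "CARD('p) - 1"]) auto
  from LeastI_ex[OF this] have "char_power \<xi> (int 12) = triv_char"
    using order_xi unfolding char_order_def by simp
  then show "x \<noteq> 0 \<Longrightarrow> \<xi> x ^ 12 = 1" unfolding char_power_eq_triv_iff by blast
qed

lemma xi_power_neq_1:
  assumes "0 < n" "n < 12"
  shows "\<exists>x. x \<noteq> 0 \<and> \<xi> x ^ n \<noteq> 1"
proof -
  have "\<not> (n > 0 \<and> char_power \<xi> (int n) = triv_char)"
    by (rule not_less_Least) (use assms order_xi in \<open>simp add: char_order_def\<close>)
  then show ?thesis using assms char_power_eq_triv_iff by blast
qed

section \<open>The quadratic character and the trace of the curve\<close>

text \<open>\<open>\<xi> ^ 6\<close> is nontrivial with trivial square, so it is \<open>-1\<close>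
  at a generator and detects the parity of the discrete logarithm.\<close>

lemma quad_char_eq: "quad_char x = \<xi> x ^ 6"
proof -
  obtain g :: "'p mod_ring" where g: "g \<noteq> 0" "bij_betw (\<lambda>i. g ^ i) {..<CARD('p) - 1} (- {0})"
    by (rule primitive_root_exists)
  have gpow: "\<exists>i<CARD('p) - 1. x = g ^ i" if "x \<noteq> 0" for x
    using g that by (auto simp: bij_betw_def)
  have "\<xi> g ^ 6 \<noteq> 1"
  proof
    assume *: "\<xi> g ^ 6 = 1"
    obtain x where x: "x \<noteq> 0" "\<xi> x ^ 6 \<noteq> 1" using xi_power_neq_1[of 6] by auto
    then obtain i where "x = g ^ i" using gpow by blast
    then have "\<xi> x ^ 6 = (\<xi> g ^ 6) ^ i" by (simp add: xi_simps power_mult[symmetric] mult.commute)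
    then show False using * x by simp
  qed
  moreover have "(\<xi> g ^ 6)\<^sup>2 = 1" using xi_power_12[OF g(1)] by (simp add: power_mult[symmetric])
  ultimately have g6: "\<xi> g ^ 6 = -1" using power2_eq_1_iff by blast
  show ?thesis
  proof (cases "x = 0")
    case True
    then show ?thesis by (simp add: quad_char_def xi_simps)
  next
    case x: False
    show ?thesis
    proof (cases "\<exists>y. x = y ^ 2")
      case True
      then obtain y where y: "x = y ^ 2" by blast
      then have "\<xi> x ^ 6 = \<xi> y ^ 12" by (simp add: xi_simps power_mult[symmetric])
      moreover have "y \<noteq> 0" using x y by auto
      ultimately show ?thesis using x True xi_power_12 by (simp add: quad_char_def)
    next
      case False
      obtain i where i: "x = g ^ i" using gpow[OF x] by blast
      have "odd i"
      proof
        assume "even i"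
        then obtain j where "i = 2 * j" by blast
        then have "x = (g ^ j) ^ 2" using i by (simp add: power_mult[symmetric] mult.commute)
        then show False using False by blast
      qed
      have "\<xi> x ^ 6 = (\<xi> g ^ 6) ^ i"
        unfolding i by (simp add: xi_simps power_mult[symmetric] mult.commute)
      then show ?thesis using g6 \<open>odd i\<close> x False by (simp add: quad_char_def)
    qed
  qed
qed

lemma quad_char_mult: "quad_char (x * y) = quad_char x * (quad_char (y :: 'p mod_ring))"
  by (simp add: quad_char_eq xi_simps power_mult_distrib)

lemma quad_char_square: "quad_char ((c :: 'p mod_ring)\<^sup>2) = of_bool (c \<noteq> 0)"
  by (auto simp: quad_char_def)

lemma quad_char_values: "quad_char (x :: 'p mod_ring) \<in> {0, 1, -1}"
  by (simp add: quad_char_def)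

lemma quad_char_mult_eq_1:
  "quad_char x * quad_char y = 1 \<Longrightarrow> quad_char x = quad_char y" for x y :: "'p mod_ring"
  using quad_char_values[of x] quad_char_values[of y] by auto

lemma quad_char_mult_eq_minus_1:
  "quad_char x * quad_char y = -1 \<Longrightarrow> quad_char x + quad_char y = 0" for x y :: "'p mod_ring"
  using quad_char_values[of x] quad_char_values[of y] by auto

lemma quad_char_mult_self: "x \<noteq> 0 \<Longrightarrow> quad_char x * quad_char (x :: 'p mod_ring) = 1"
  by (simp add: quad_char_def)

lemma of_nat_neq_0:
  assumes "0 < n" "n < 13"
  shows "(of_nat n :: 'p mod_ring) \<noteq> 0"
proof
  assume "(of_nat n :: 'p mod_ring) = 0"
  then have "CARD('p) \<le> n" using of_nat_0_mod_ring_dvd assms by (intro dvd_imp_le) auto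
  then show False using assms card_ge_13 by simp
qed

lemma two_neq_0: "(2 :: 'p mod_ring) \<noteq> 0" using of_nat_neq_0[of 2] by simp
lemma three_neq_0: "(3 :: 'p mod_ring) \<noteq> 0" using of_nat_neq_0[of 3] by simp
lemma four_neq_0: "(4 :: 'p mod_ring) \<noteq> 0" using of_nat_neq_0[of 4] by simp

lemma neq_uminus:
  fixes x :: "'p mod_ring"
  assumes "x \<noteq> 0"
  shows "x \<noteq> - x"
proof
  assume *: "x = - x"
  have "2 * x = x - (- x)" by simp
  also have "\<dots> = 0" unfolding *[symmetric] by (rule diff_self)
  finally show False using assms two_neq_0 by simp
qed

text \<open>Since 3 divides \<open>p - 1\<close>, the power of a generator with exponent
  \<open>(p - 1) div 3\<close> is a cube root of unity other than \<open>1\<close>.\<close>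

lemma cube_root_of_unity: obtains \<zeta> :: "'p mod_ring" where "\<zeta>\<^sup>2 + \<zeta> + 1 = 0"
proof -
  let ?n = "CARD('p) - 1"
  obtain g :: "'p mod_ring" where g: "g \<noteq> 0" "bij_betw (\<lambda>i. g ^ i) {..<?n} (- {0})"
    by (rule primitive_root_exists)
  have d: "?n div 3 * 3 = ?n" by (rule card_eq_12_times) simp
  define \<zeta> where "\<zeta> = g ^ (?n div 3)"
  have "\<zeta> ^ 3 = g ^ ?n" unfolding \<zeta>_def power_mult[symmetric] d ..
  then have "\<zeta> ^ 3 = 1" using power_CARD_minus_1[OF g(1)] by simp
  moreover have "\<zeta> ^ 3 - 1 = (\<zeta> - 1) * (\<zeta>\<^sup>2 + \<zeta> + 1)"
    by (simp add: algebra_simps power2_eq_square power3_eq_cube)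
  moreover have "\<zeta> \<noteq> 1"
  proof
    assume "\<zeta> = 1"
    then have "g ^ (?n div 3) = g ^ 0" by (simp add: \<zeta>_def)
    moreover have "?n div 3 < ?n" "0 < ?n" using card_ge_13 by auto
    ultimately have "?n div 3 = 0" using g(2) unfolding bij_betw_def inj_on_def by blast
    then show False using card_ge_13 by simp
  qed
  ultimately show ?thesis using that[of \<zeta>] by simp
qed

lemma sum_quad_char_affine:
  "(\<Sum>x\<in>UNIV. quad_char (a * x + b)) = (if a = 0 then of_nat CARD('p) * quad_char b else (0::complex))"
      for a b :: "'p mod_ring"
proof (cases "a = 0")
  case False
  have "(\<Sum>x\<in>UNIV. quad_char (a * x + b)) = (\<Sum>x\<in>UNIV. quad_char (x :: 'p mod_ring))"
    by (rule sum.reindex_bij_witness[of _ "\<lambda>x. (x - b) / a" "\<lambda>x. a * x + b"]) (use False in auto)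
  also have "\<dots> = (\<Sum>x\<in>UNIV. char_power \<xi> 6 x)"
    by (intro sum.cong refl) (auto simp: quad_char_eq char_power_def xi_simps)
  also have "\<dots> = 0"
  proof -
    obtain x where "x \<noteq> 0" "\<xi> x ^ 6 \<noteq> 1" using xi_power_neq_1[of 6] by auto
    then show ?thesis
      by (intro sum_mult_char_eq_0[of _ x] mult_char_char_power xi) (auto simp: char_power_def)
  qed
  finally show ?thesis using False by simp
qed simp

lemma card_square_roots: "of_nat (card {y :: 'p mod_ring. y ^ 2 = c}) = 1 + (quad_char c :: complex)"
proof (cases "c = 0")
  case False
  show ?thesis
  proof (cases "\<exists>y. c = y ^ 2")
    case True
    then obtain y where y: "c = y ^ 2" by blast
    then have "{z. z ^ 2 = c} = {y, - y}" by (auto simp: power2_eq_iff)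
    moreover have "y \<noteq> - y" using y False by (intro neq_uminus) auto
    ultimately show ?thesis using True False by (simp add: quad_char_def)
  next
    case ns: False
    then have "{z. z ^ 2 = c} = {}" by auto
    then show ?thesis using ns False by (simp add: quad_char_def)
  qed
qed (simp add: quad_char_def)

text \<open>Each \<open>x\<close> carries \<open>1 + quad_char (f x)\<close> points, where
  \<open>f\<close> is the cubic on the right of the curve equation. The ones add up to
  \<open>p\<close>, and the point at infinity cancels the remaining \<open>1\<close>.\<close>

lemma curve_trace_eq:
  "of_int (curve_trace t) = - (\<Sum>x\<in>UNIV. (quad_char (4 * x ^ 3 - 27 / (1 - t) * x
      - 27 / (1 - t)) :: complex))" for t :: "'p mod_ring"
proof -
  let ?c = "\<lambda>x. 4 * x ^ 3 - 27 / (1 - t) * x - 27 / (1 - t)"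
  have "curve_points t = (SIGMA x:UNIV. {y. y ^ 2 = ?c x})"
    by (auto simp: curve_points_def)
  then have "card (curve_points t) = (\<Sum>x\<in>UNIV. card {y. y ^ 2 = ?c x})" by simp
  then have "of_nat (card (curve_points t)) = (\<Sum>x\<in>UNIV. 1 + (quad_char (?c x) :: complex))"
    by (simp only: of_nat_sum card_square_roots)
  then show ?thesis by (simp add: curve_trace_def sum.distrib)
qed

section \<open>The quadratic identity\<close>

text \<open>If both equations are solvable, \<open>x * (a + 2 * e) = (x + e)\<^sup>2\<close> shows
  that \<open>a + 2 * e\<close> has the quadratic character of \<open>x\<close>, unless
  \<open>x = - e\<close> makes it vanish. If only one is solvable, its two terms have product
  \<open>-1\<close> and cancel.\<close>

lemma quadratic_fibre_identity:
  fixes a b :: "'p mod_ring"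
  assumes b: "b \<noteq> 0"
  shows "(\<Sum>e\<in>UNIV. of_bool (e\<^sup>2 = b) * quad_char (a + 2 * e))
       = (\<Sum>x\<in>UNIV. of_bool (x * (a - x) = b) * (quad_char x :: complex))"
proof -
  have lhs: "(\<Sum>e\<in>UNIV. of_bool (e\<^sup>2 = b) * quad_char (a + 2 * e))
      = (\<Sum>e\<in>{e. e\<^sup>2 = b}. (quad_char (a + 2 * e) :: complex))"
    by (rule sum.mono_neutral_cong_right) auto
  have rhs: "(\<Sum>x\<in>UNIV. of_bool (x * (a - x) = b) * quad_char x)
      = (\<Sum>x\<in>{x. x * (a - x) = b}. (quad_char x :: complex))"
    by (rule sum.mono_neutral_cong_right) auto
  have roots: "{x'. x' * (a - x') = b} = {x, a - x}" if "x * (a - x) = b" for x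
  proof -
    have "x' * (a - x') = b \<longleftrightarrow> x' \<in> {x, a - x}" for x'
    proof -
      have "(x' - x) * (x' - (a - x)) = x * (a - x) - x' * (a - x')" by (simp add: algebra_simps)
      then have "x' * (a - x') = b \<longleftrightarrow> (x' - x) * (x' - (a - x)) = 0" using that by auto
      then show ?thesis by auto
    qed
    then show ?thesis by blast
  qed
  show ?thesis
  proof (cases "\<exists>e. e\<^sup>2 = b")
    case False
    have "(\<Sum>x\<in>{x. x * (a - x) = b}. (quad_char x :: complex)) = 0"
    proof (cases "\<exists>x. x * (a - x) = b")
      case True
      then obtain x where x: "x * (a - x) = b" by blast
      have "x \<noteq> a - x" using x False by (metis power2_eq_square)
      moreover have "quad_char x + quad_char (a - x) = (0::complex)"
      proof -
        have "quad_char x * quad_char (a - x) = (-1 :: complex)"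
          using False b unfolding quad_char_mult[symmetric] x by (auto simp: quad_char_def)
        then show ?thesis by (rule quad_char_mult_eq_minus_1)
      qed
      ultimately show ?thesis unfolding roots[OF x] by simp
    qed simp
    moreover have "{e. e\<^sup>2 = b} = {}" using False by auto
    ultimately show ?thesis unfolding lhs rhs by simp
  next
    case True
    then obtain e where e: "e\<^sup>2 = b" by blast
    have e0: "e \<noteq> 0" using e b by auto
    have ne: "e \<noteq> - e" using e0 by (rule neq_uminus)
    have "{e'. e'\<^sup>2 = b} = {e, - e}" using e by (auto simp: power2_eq_iff)
    then have L: "(\<Sum>e\<in>{e. e\<^sup>2 = b}. (quad_char (a + 2 * e) :: complex))
        = quad_char (a + 2 * e) + quad_char (a - 2 * e)"
      using ne by simp
    have "(\<Sum>x\<in>{x. x * (a - x) = b}. (quad_char x :: complex))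
        = quad_char (a + 2 * e) + quad_char (a - 2 * e)"
    proof (cases "\<exists>x. x * (a - x) = b")
      case True
      then obtain x where x: "x * (a - x) = b" by blast
      have x0: "x \<noteq> 0" using x b by auto
      have inv: "quad_char x * quad_char x = (1::complex)" using x0 by (rule quad_char_mult_self)
      have key: "quad_char (a + 2 * c) = (if x = - c then 0 else quad_char x :: complex)"
        if "c\<^sup>2 = b" for c
      proof -
        have "x * (a + 2 * c) = (x + c)\<^sup>2"
          using x that by (simp add: algebra_simps power2_eq_square)
        then have "quad_char x * quad_char (a + 2 * c) = (of_bool (x + c \<noteq> 0) :: complex)"
          by (metis quad_char_mult quad_char_square)
        then have "quad_char x * (quad_char x * quad_char (a + 2 * c))
            = quad_char x * (of_bool (x + c \<noteq> 0) :: complex)"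
          by simp
        then show ?thesis using inv by (simp add: mult.assoc[symmetric] eq_neg_iff_add_eq_0)
      qed
      have other: "quad_char (a - x) = (quad_char x :: complex)"
      proof -
        have "quad_char x * quad_char (a - x) = (1 :: complex)"
          unfolding quad_char_mult[symmetric] x e[symmetric] using e0 by (simp add: quad_char_square)
        then show ?thesis by (rule quad_char_mult_eq_1[symmetric])
      qed
      \<comment> \<open>A double root occurs exactly when \<open>x\<close> is \<open>e\<close> or
        \<open>- e\<close>, hence when one of the two terms \<open>quad_char (a + 2 * e)\<close> and
        \<open>quad_char (a - 2 * e)\<close> vanishes; both sides then have one term.\<close>
      have "x = a - x \<longleftrightarrow> x = e \<or> x = - e"
      proof -
        have "x = a - x \<longleftrightarrow> x * x = x * (a - x)" using x0 by simp
        also have "\<dots> \<longleftrightarrow> x\<^sup>2 = e\<^sup>2" using x e by (simp add: power2_eq_square)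
        finally show ?thesis by (simp add: power2_eq_iff)
      qed
      moreover have "(\<Sum>x'\<in>{x, a - x}. (quad_char x' :: complex))
          = quad_char x + (if x = a - x then 0 else quad_char x)"
        using other by (cases "x = a - x") auto
      ultimately have R: "(\<Sum>x'\<in>{x, a - x}. (quad_char x' :: complex))
          = quad_char x + (if x = e \<or> x = - e then 0 else quad_char x)" by (simp only:)
      have K: "quad_char (a + 2 * e) = (if x = - e then 0 else quad_char x :: complex)"
        "quad_char (a - 2 * e) = (if x = e then 0 else quad_char x :: complex)"
        using key[of e] key[of "- e"] e by simp_all
      have "\<not> (x = e \<and> x = - e)" using ne by blast
      then show ?thesis unfolding roots[OF x] R K
          by (cases "x = e"; cases "x = - e") (simp_all only: if_True if_False, simp_all)
    next
      case False
      \<comment> \<open>The product is the discriminant \<open>a\<^sup>2 - 4 * b\<close> of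
        \<open>x * (a - x) = b\<close>; a square root \<open>d\<close> would give the solution
        \<open>(a + d) / 2\<close>.\<close>
      have "\<nexists>d. (a + 2 * e) * (a - 2 * e) = d\<^sup>2"
      proof
        assume "\<exists>d. (a + 2 * e) * (a - 2 * e) = d\<^sup>2"
        then obtain d where d: "(a + 2 * e) * (a - 2 * e) = d\<^sup>2" by blast
        have "(a + d) / 2 * (a - (a + d) / 2) = (a\<^sup>2 - d\<^sup>2) / 4"
          using two_neq_0 four_neq_0 by (simp add: field_simps power2_eq_square)
        also have "\<dots> = b"
          unfolding d[symmetric] e[symmetric] using four_neq_0
              by (simp add: field_simps power2_eq_square)
        finally show False using False by blast
      qed
      moreover have "(a + 2 * e) * (a - 2 * e) \<noteq> 0" using calculation by (metis power_zero_numeral)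
      ultimately have "quad_char ((a + 2 * e) * (a - 2 * e)) = (-1::complex)"
        by (simp add: quad_char_def)
      then have "quad_char (a + 2 * e) * quad_char (a - 2 * e) = (-1::complex)"
        by (simp only: quad_char_mult)
      then have "quad_char (a + 2 * e) + quad_char (a - 2 * e) = (0::complex)"
        by (rule quad_char_mult_eq_minus_1)
      then show ?thesis using False by simp
    qed
    then show ?thesis unfolding lhs rhs L by simp
  qed
qed

section \<open>From the curve to Greene's function\<close>

text \<open>The cubic identity with \<open>\<omega> = \<xi> ^ 4\<close>. For fixed \<open>y\<close>
  and \<open>z\<close> the test function is affine in \<open>x\<close> with coefficient
  \<open>27 * (4 * r * y * z - 1)\<close>, so only \<open>z = 1 / (4 * r * y)\<close> survives the
  sum over \<open>x\<close>.\<close>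

lemma cubic_sum_eq:
  fixes r :: "'p mod_ring"
  assumes r: "r \<noteq> 0"
  shows "(\<Sum>x\<in>UNIV. quad_char (4 * r * x ^ 3 - 27 * x - 27))
    = \<xi> (4 * r) ^ 10 * (\<Sum>y\<in>UNIV. \<xi> y ^ 2 * quad_char (4 * r * y\<^sup>2 + 4 * r * y + 1))"
proof -
  obtain \<zeta> :: "'p mod_ring" where zeta: "\<zeta>\<^sup>2 + \<zeta> + 1 = 0" by (rule cube_root_of_unity)
  let ?w = "\<lambda>x. \<xi> x ^ 4"
  let ?p = "of_nat CARD('p) :: complex"
  have w: "?w \<in> mult_chars" by (simp add: mult_chars_def xi_simps power_mult_distrib)
  have w_cube: "(\<xi> x ^ 4) ^ 3 = 1" if "x \<noteq> 0" for x
    using xi_power_12[OF that] by (simp add: power_mult[symmetric])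
  have w_nontrivial: "\<exists>x. x \<noteq> 0 \<and> \<xi> x ^ 4 \<noteq> 1" using xi_power_neq_1[of 4] by simp
  have three: "(27 :: 'p mod_ring) \<noteq> 0"
  proof -
    have "(27 :: 'p mod_ring) = 3 ^ 3" by simp
    then show ?thesis using three_neq_0 by (metis power_not_zero)
  qed
  \<comment> \<open>\<open>2 * \<zeta> + 1\<close> is a square root of \<open>-3\<close>. So
    \<open>-27\<close> is a square, and the factor \<open>-27\<close> left after the collapse drops
    out of \<open>quad_char\<close>.\<close>
  have "(-27 :: 'p mod_ring) = (3 * (2 * \<zeta> + 1))\<^sup>2 - 36 * (\<zeta>\<^sup>2 + \<zeta> + 1)"
    by (simp add: algebra_simps power2_eq_square)
  then have sq: "(-27 :: 'p mod_ring) = (3 * (2 * \<zeta> + 1))\<^sup>2" unfolding zeta by simp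
  moreover from this have "3 * (2 * \<zeta> + 1) \<noteq> 0"
    using three by (metis neg_equal_0_iff_equal power_zero_numeral)
  ultimately have q27: "quad_char (-27 :: 'p mod_ring) = 1" by (simp only: quad_char_square) simp
  \<comment> \<open>As \<open>108 = 4 * 3 ^ 3\<close>, the point \<open>(3 * e, e ^ 3)\<close> gives
    the curve's cubic at \<open>3 * e\<close>. The nonzero slope \<open>-27\<close> in
    \<open>a\<close> removes the second term of the cubic identity.\<close>
  define h where "h a b = (quad_char (108 * r * b - 27 * (a + 1)) :: complex)" for a b
  have "?p * (\<Sum>e\<in>UNIV. h (3 * e) (e ^ 3)) - (\<Sum>e\<in>UNIV. \<Sum>a\<in>UNIV. h a (e ^ 3))
     = (\<Sum>x\<in>UNIV. \<Sum>y\<in>UNIV. \<Sum>z\<in>UNIV. \<xi> y ^ 4 * cnj (\<xi> z ^ 4) * h (x + y + z) (x * y * z))"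
    by (rule cubic_sum_identity[OF w w_cube w_nontrivial zeta three_neq_0, symmetric])
  also have "(\<Sum>e\<in>UNIV. \<Sum>a\<in>UNIV. h a (e ^ 3)) = 0"
  proof (rule sum.neutral, rule ballI)
    fix e
    have "(\<Sum>a\<in>UNIV. h a (e ^ 3)) = (\<Sum>a\<in>UNIV. quad_char ((-27) * a + (108 * r * e ^ 3 - 27)))"
      unfolding h_def by (simp add: algebra_simps)
    then show "(\<Sum>a\<in>UNIV. h a (e ^ 3)) = 0" unfolding sum_quad_char_affine using three by simp
  qed
  also have "(\<Sum>e\<in>UNIV. h (3 * e) (e ^ 3))
      = (\<Sum>e\<in>UNIV. quad_char (4 * r * (3 * e) ^ 3 - 27 * (3 * e) - 27))"
    by (intro sum.cong refl) (simp add: h_def algebra_simps power_mult_distrib)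
  also have "\<dots> = (\<Sum>x\<in>UNIV. quad_char (4 * r * x ^ 3 - 27 * x - 27))"
    by (rule sum_scale_mod_ring[OF three_neq_0])
  also have "(\<Sum>x\<in>UNIV. \<Sum>y\<in>UNIV. \<Sum>z\<in>UNIV. \<xi> y ^ 4 * cnj (\<xi> z ^ 4) * h (x + y + z) (x * y * z))
     = (\<Sum>y\<in>UNIV. \<Sum>z\<in>UNIV. \<xi> y ^ 4 * cnj (\<xi> z ^ 4) * (\<Sum>x\<in>UNIV. h (x + y + z) (x * y * z)))"
    unfolding sum_distrib_left
    by (subst sum.swap) (intro sum.cong refl sum.swap)
  also have "\<dots> = (\<Sum>y\<in>UNIV. ?p * (\<xi> (4 * r) ^ 10 * (\<xi> y ^ 2 * quad_char (4 * r * y\<^sup>2 + 4 * r * y + 1))))"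
  proof (intro sum.cong refl)
    fix y
    show "(\<Sum>z\<in>UNIV. \<xi> y ^ 4 * cnj (\<xi> z ^ 4) * (\<Sum>x\<in>UNIV. h (x + y + z) (x * y * z)))
        = ?p * (\<xi> (4 * r) ^ 10 * (\<xi> y ^ 2 * quad_char (4 * r * y\<^sup>2 + 4 * r * y + 1)))"
    proof (cases "y = 0")
      case True
      then show ?thesis by (simp add: xi_simps)
    next
      case y: False
      let ?c = "4 * r * y"
      have c: "?c \<noteq> 0" using y r four_neq_0 by simp
      have "(\<Sum>z\<in>UNIV. \<xi> y ^ 4 * cnj (\<xi> z ^ 4) * (\<Sum>x\<in>UNIV. h (x + y + z) (x * y * z)))
         = (\<Sum>z\<in>UNIV. if z = 1 / ?c then \<xi> y ^ 4 * cnj (\<xi> z ^ 4) * (?p * quad_char (y + z + 1)) else 0)"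
      proof (intro sum.cong refl)
        fix z
        have "(\<Sum>x\<in>UNIV. h (x + y + z) (x * y * z))
            = (\<Sum>x\<in>UNIV. quad_char (27 * (?c * z - 1) * x + (-27) * (y + z + 1)))"
          unfolding h_def by (simp add: algebra_simps)
        also have "\<dots> = (if z = 1 / ?c then ?p * quad_char (y + z + 1) else 0)"
        proof -
          have "27 * (?c * z - 1) = 0 \<longleftrightarrow> z * ?c = 1"
            unfolding mult.commute[of z] mult_eq_0_iff right_minus_eq using three by blast
          then have "27 * (?c * z - 1) = 0 \<longleftrightarrow> z = 1 / ?c"
            unfolding nonzero_eq_divide_eq[OF c] .
          then show ?thesis unfolding sum_quad_char_affine quad_char_mult q27 by simp
        qed
        finally show "\<xi> y ^ 4 * cnj (\<xi> z ^ 4) * (\<Sum>x\<in>UNIV. h (x + y + z) (x * y * z))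
          = (if z = 1 / ?c then \<xi> y ^ 4 * cnj (\<xi> z ^ 4) * (?p * quad_char (y + z + 1)) else 0)" by simp
      qed
      also have "\<dots> = ?p * (\<xi> y ^ 4 * \<xi> ?c ^ 4 * quad_char (y + 1 / ?c + 1))"
      proof -
        have "cnj (\<xi> (1 / ?c) ^ 4) = \<xi> ?c ^ 4"
          unfolding complex_cnj_power cnj_mult_char[OF xi]
          unfolding mult_char_divide[OF xi] mult_char_1[OF xi] by simp
        then show ?thesis by simp
      qed
      also have "y + 1 / ?c + 1 = (4 * r * y\<^sup>2 + 4 * r * y + 1) / ?c"
        using c by (simp add: field_simps power2_eq_square)
      \<comment> \<open>A value of \<open>\<xi> ^ 6\<close> at a nonzero element is its own inverse;
        writing it with a positive exponent merges it with \<open>\<xi> ?c ^ 4\<close> to the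
        exponent 10.\<close>
      also have "quad_char ((4 * r * y\<^sup>2 + 4 * r * y + 1) / ?c)
          = quad_char (4 * r * y\<^sup>2 + 4 * r * y + 1) * \<xi> ?c ^ 6"
      proof -
        have "\<xi> ?c ^ 6 * \<xi> ?c ^ 6 = 1" using xi_power_12[OF c] by (simp add: power_add[symmetric])
        then have "inverse (\<xi> ?c ^ 6) = \<xi> ?c ^ 6" by (rule inverse_unique)
        then show ?thesis
          unfolding quad_char_eq mult_char_divide[OF xi] power_divide by (simp only: divide_inverse)
      qed
      also have "\<xi> y ^ 4 * \<xi> ?c ^ 4 * (quad_char (4 * r * y\<^sup>2 + 4 * r * y + 1) * \<xi> ?c ^ 6)
         = \<xi> (4 * r) ^ 10 * (\<xi> y ^ 12 * \<xi> y ^ 2 * quad_char (4 * r * y\<^sup>2 + 4 * r * y + 1))"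
        unfolding mult_char_mult[OF xi, of "4 * r" y] power_mult_distrib
        by (simp add: mult_ac power_add[symmetric])
      finally show ?thesis using xi_power_12[OF y] by simp
    qed
  qed
  finally have "?p * (\<Sum>x\<in>UNIV. quad_char (4 * r * x ^ 3 - 27 * x - 27))
     = ?p * (\<xi> (4 * r) ^ 10 * (\<Sum>y\<in>UNIV. \<xi> y ^ 2 * quad_char (4 * r * y\<^sup>2 + 4 * r * y + 1)))"
    by (simp only: sum_distrib_left diff_0_right)
  then show ?thesis by simp
qed

text \<open>The factor \<open>\<xi> y ^ 2\<close> depends only on \<open>b = y\<^sup>2\<close>, so
  \<open>quadratic_fibre_identity\<close> applies on each fibre. It replaces the square roots of
  \<open>b\<close> by solutions of \<open>x * (2 * b + c - x) = b\<close>, an equation linear in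
  \<open>b\<close>, so \<open>b\<close> can be eliminated.\<close>

lemma quadratic_sum_eq:
  fixes r :: "'p mod_ring"
  assumes r: "r \<noteq> 0" "r \<noteq> 1"
  shows "\<xi> (4 * r) * (\<Sum>y\<in>UNIV. \<xi> y ^ 2 * quad_char (4 * r * y\<^sup>2 + 4 * r * y + 1))
       = (\<Sum>y\<in>UNIV. \<xi> y ^ 5 * \<xi> (1 - y) * cnj (\<xi> (1 - r * y)))"
proof -
  \<comment> \<open>With this \<open>c\<close> the quadratic is \<open>2 * r\<close> times
    \<open>a + 2 * e\<close> for \<open>a = 2 * e\<^sup>2 + c\<close>, the shape the quadratic
    identity expects.\<close>
  define c where "c = 1 / (2 * r)"
  have r2: "2 * r \<noteq> 0" using r two_neq_0 by simp
  have cr: "2 * r * c = 1" using r2 by (simp add: c_def)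
  have "(\<Sum>y\<in>UNIV. \<xi> y ^ 2 * quad_char (4 * r * y\<^sup>2 + 4 * r * y + 1))
     = (\<Sum>e\<in>UNIV. quad_char (2 * r) * (\<xi> (e\<^sup>2) * quad_char (2 * e\<^sup>2 + c + 2 * e)))"
  proof (intro sum.cong refl)
    fix e
    have "4 * r * e\<^sup>2 + 4 * r * e + 1 = 2 * r * (2 * e\<^sup>2 + c + 2 * e)"
      using cr by (simp add: algebra_simps)
    then show "\<xi> e ^ 2 * quad_char (4 * r * e\<^sup>2 + 4 * r * e + 1)
        = quad_char (2 * r) * (\<xi> (e\<^sup>2) * quad_char (2 * e\<^sup>2 + c + 2 * e))"
      by (simp only: quad_char_mult mult_char_power[OF xi] mult_ac)
  qed
  also have "\<dots> = quad_char (2 * r) * (\<Sum>e\<in>UNIV. \<Sum>b\<in>UNIV. of_bool (e\<^sup>2 = b)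
      * (\<xi> b * quad_char (2 * b + c + 2 * e)))"
    unfolding sum_distrib_left[symmetric]
    by (simp add: of_bool_def if_distrib if_distribR cong: if_cong)
  also have "(\<Sum>e\<in>UNIV. \<Sum>b\<in>UNIV. of_bool (e\<^sup>2 = b) * (\<xi> b * quad_char (2 * b + c + 2 * e)))
     = (\<Sum>b\<in>UNIV. \<xi> b * (\<Sum>e\<in>UNIV. of_bool (e\<^sup>2 = b) * quad_char (2 * b + c + 2 * e)))"
    unfolding sum_distrib_left by (subst sum.swap) (simp only: mult_ac)
  also have "\<dots> = (\<Sum>b\<in>UNIV. \<xi> b * (\<Sum>x\<in>UNIV. of_bool (x * (2 * b + c - x) = b) * quad_char x))"
  proof (intro sum.cong refl)
    fix b
    show "\<xi> b * (\<Sum>e\<in>UNIV. of_bool (e\<^sup>2 = b) * quad_char (2 * b + c + 2 * e))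
        = \<xi> b * (\<Sum>x\<in>UNIV. of_bool (x * (2 * b + c - x) = b) * quad_char x)"
    proof (cases "b = 0")
      case False
      then show ?thesis by (simp only: quadratic_fibre_identity not_False_eq_True)
    qed (simp only: mult_char_0[OF xi] mult_zero_left)
  qed
  also have "\<dots> = (\<Sum>x\<in>UNIV. \<Sum>b\<in>UNIV. of_bool (x * (2 * b + c - x) = b) * (\<xi> b * quad_char x))"
    unfolding sum_distrib_left by (subst sum.swap) (simp only: mult_ac)
  also have "\<dots> = (\<Sum>x\<in>UNIV. quad_char x * \<xi> (x * (c - x) / (1 - 2 * x)))"
  proof (intro sum.cong refl)
    fix x
    show "(\<Sum>b\<in>UNIV. of_bool (x * (2 * b + c - x) = b) * (\<xi> b * quad_char x))
        = quad_char x * \<xi> (x * (c - x) / (1 - 2 * x))"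
    proof (cases "1 - 2 * x = 0")
      case True
      then have x: "2 * x = 1" by simp
      \<comment> \<open>At \<open>x = 1 / 2\<close> the unknown \<open>b\<close> drops out and
        solvability would force \<open>c = x\<close>, that is \<open>r = 1\<close>.\<close>
      have "x * (2 * b + c - x) \<noteq> b" for b
      proof
        assume "x * (2 * b + c - x) = b"
        moreover have "x * (2 * b + c - x) = b * (2 * x) + x * (c - x)" by (simp add: algebra_simps)
        ultimately have "x * (c - x) = 0" using x by simp
        then have "c = x" using x by auto
        then have "2 * r * c = r" using x by (simp add: algebra_simps)
        then show False using cr r by simp
      qed
      then have "(\<Sum>b\<in>UNIV. of_bool (x * (2 * b + c - x) = b) * (\<xi> b * quad_char x)) = 0" by simp
      then show ?thesis using True by (simp add: xi_simps)
    next
      case False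
      have iff: "x * (2 * b + c - x) = b \<longleftrightarrow> b = x * (c - x) / (1 - 2 * x)" for b
      proof -
        have "x * (2 * b + c - x) - b = x * (c - x) - b * (1 - 2 * x)" by (simp add: algebra_simps)
        then have "x * (2 * b + c - x) = b \<longleftrightarrow> b * (1 - 2 * x) = x * (c - x)" by (metis right_minus_eq)
        then show ?thesis using False by (simp add: nonzero_eq_divide_eq)
      qed
      show ?thesis unfolding iff by (simp add: of_bool_def if_distrib if_distribR mult.commute cong:
          if_cong)
    qed
  qed
  also have "\<dots> = (\<Sum>x\<in>-{0}. quad_char x * \<xi> (x * (c - x) / (1 - 2 * x)))"
    by (rule sum.mono_neutral_right) (auto simp: xi_simps)
  \<comment> \<open>The substitution \<open>x = c / y\<close> moves the zero \<open>x = c\<close> to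
    \<open>y = 1\<close> and the pole \<open>x = 1 / 2\<close> to \<open>y = 1 / r\<close>.\<close>
  also have "\<dots> = (\<Sum>y\<in>-{0}. quad_char (2 * r * y) * \<xi> ((1 - y) / (4 * r * (y * (1 - r * y)))))"
  proof (rule sum.reindex_bij_witness[of _ "\<lambda>y. 1 / (2 * r * y)" "\<lambda>x. 1 / (2 * r * x)"])
    fix x :: "'p mod_ring" assume "x \<in> - {0}"
    then have x: "x \<noteq> 0" by simp
    show "1 / (2 * r * (1 / (2 * r * x))) = x" "1 / (2 * r * (1 / (2 * r * x))) = x"
      "1 / (2 * r * x) \<in> - {0}" "1 / (2 * r * x) \<in> - {0}"
      using x r2 by simp_all
    define y where "y = 1 / (2 * r * x)"
    have y: "y \<noteq> 0" using x r2 by (simp add: y_def)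
    have xy: "x = c / y" using x r2 by (simp add: y_def c_def)
    have "quad_char (2 * r * y) = quad_char x"
    proof -
      have "2 * r * y * x = 1" using x r2 by (simp add: y_def)
      then have "quad_char (2 * r * y) * quad_char x = (1::complex)"
        unfolding quad_char_mult[symmetric] by (simp add: quad_char_eq xi_simps)
      then show ?thesis by (rule quad_char_mult_eq_1)
    qed
    moreover have "(1 - y) / (4 * r * (y * (1 - r * y))) = x * (c - x) / (1 - 2 * x)"
    proof -
      have a: "x * (c - x) = - c * c * (1 - y) / (y * y)" unfolding xy using y by (simp add: field_simps)
      have b: "1 - 2 * x = - (2 * c) * (1 - r * y) / y"
        unfolding xy using y cr by (simp add: field_simps)
      have c0: "c \<noteq> 0" using cr by auto
      have "(- c * c * m / (y * y)) / (- (2 * c) * n / y) = c * m / (2 * y * n)" for m n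
        using y c0 two_neq_0 by (cases "n = 0") (simp_all add: field_simps)
      then have "x * (c - x) / (1 - 2 * x) = c * (1 - y) / (2 * y * (1 - r * y))"
        unfolding a b .
      also have "\<dots> = (1 - y) / (4 * r * (y * (1 - r * y)))"
        unfolding c_def using r2 two_neq_0 by (simp add: field_simps)
      finally show ?thesis by simp
    qed
    ultimately show "quad_char (2 * r * (1 / (2 * r * x)))
        * \<xi> ((1 - 1 / (2 * r * x)) / (4 * r * (1 / (2 * r * x) * (1 - r * (1 / (2 * r * x))))))
            = quad_char x * \<xi> (x * (c - x) / (1 - 2 * x))"
      unfolding y_def by simp
  qed
  also have "\<dots> = (\<Sum>y\<in>UNIV. quad_char (2 * r) * inverse (\<xi> (4 * r))
      * (\<xi> y ^ 5 * \<xi> (1 - y) * cnj (\<xi> (1 - r * y))))"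
  proof (rule sum.mono_neutral_cong_left)
    fix y :: "'p mod_ring" assume "y \<in> - {0}"
    then have y: "\<xi> y \<noteq> 0" by (simp add: xi_simps)
    \<comment> \<open>The factor \<open>\<xi> y\<close> in the denominator lowers
      \<open>quad_char y = \<xi> y ^ 6\<close> to the fifth power belonging to the second parameter
      of Greene's function.\<close>
    have "quad_char y = \<xi> y ^ 5 * \<xi> y" by (simp add: quad_char_eq power_Suc2[symmetric])
    then show "quad_char (2 * r * y) * \<xi> ((1 - y) / (4 * r * (y * (1 - r * y))))
        = quad_char (2 * r) * inverse (\<xi> (4 * r)) * (\<xi> y ^ 5 * \<xi> (1 - y) * cnj (\<xi> (1 - r * y)))"
      unfolding quad_char_mult[of "2 * r" y] mult_char_divide[OF xi]
        mult_char_mult[OF xi, of "4 * r"] mult_char_mult[OF xi, of y] cnj_mult_char[OF xi] using y by (simp add: field_simps)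
  qed (auto simp: xi_simps)
  finally have "(\<Sum>y\<in>UNIV. \<xi> y ^ 2 * quad_char (4 * r * y\<^sup>2 + 4 * r * y + 1))
     = quad_char (2 * r) * quad_char (2 * r) * inverse (\<xi> (4 * r))
         * (\<Sum>y\<in>UNIV. \<xi> y ^ 5 * \<xi> (1 - y) * cnj (\<xi> (1 - r * y)))"
    unfolding sum_distrib_left[symmetric] by (simp only: mult.assoc)
  moreover have "quad_char (2 * r) * quad_char (2 * r) = (1::complex)"
    using r2 by (rule quad_char_mult_self)
  moreover have "\<xi> (4 * r) \<noteq> 0" using r four_neq_0 by (simp add: xi_simps)
  ultimately show ?thesis by simp
qed

text \<open>Chains \<open>greene_2F1_triv_eq_sum\<close>, \<open>cubic_sum_eq\<close> and
  \<open>quadratic_sum_eq\<close> at \<open>r = 1 - t\<close>. The constants agree because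
  \<open>quad_char 2 * \<xi> r ^ 3 = \<xi> (4 * r) ^ 3\<close>, and the exponent
  \<open>3 + 10\<close> of \<open>\<xi> (4 * r)\<close> reduces to \<open>1\<close> modulo
  12.\<close>

lemma greene_2F1_eq_curve_trace:
  assumes "t \<noteq> 0" "t \<noteq> 1"
  shows "of_nat CARD('p) * greene_2F1 \<xi> (char_power \<xi> 5) triv_char t =
         - quad_char (2 :: 'p mod_ring) * char_power \<xi> (-3) (1 - t) * of_int (curve_trace t)"
proof -
  define r where "r = 1 - t"
  have r: "r \<noteq> 0" "r \<noteq> 1" using assms by (auto simp: r_def)
  let ?F = "\<Sum>y\<in>UNIV. \<xi> y ^ 5 * \<xi> (1 - y) * cnj (\<xi> (1 - r * y))"
  let ?Q = "\<Sum>x\<in>UNIV. quad_char (4 * r * x ^ 3 - 27 * x - 27)"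
  let ?S = "\<Sum>y\<in>UNIV. \<xi> y ^ 2 * quad_char (4 * r * y\<^sup>2 + 4 * r * y + 1)"
  have "char_power \<xi> 5 y = \<xi> y ^ 5" for y by (simp add: char_power_def xi_simps)
  then have F: "of_nat CARD('p) * greene_2F1 \<xi> (char_power \<xi> 5) triv_char t = ?F"
    unfolding greene_2F1_triv_eq_sum[OF xi mult_char_char_power[OF xi] assms(1)] r_def by simp
  have "quad_char (4 * x ^ 3 - 27 / r * x - 27 / r)
      = quad_char r * quad_char (4 * r * x ^ 3 - 27 * x - 27)" for x
  proof -
    have eq: "r * (4 * x ^ 3 - 27 / r * x - 27 / r) = 4 * r * x ^ 3 - 27 * x - 27"
      using r by (simp add: field_simps)
    have "quad_char r * quad_char (4 * r * x ^ 3 - 27 * x - 27)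
        = quad_char r * quad_char r * quad_char (4 * x ^ 3 - 27 / r * x - 27 / r)"
      unfolding eq[symmetric] quad_char_mult by (simp only: mult.assoc)
    then show ?thesis using quad_char_mult_self[OF r(1)] by simp
  qed
  then have T: "of_int (curve_trace t) = - (quad_char r * ?Q)"
    unfolding curve_trace_eq r_def[symmetric] by (simp add: sum_distrib_left)
  \<comment> \<open>Clearing the denominator \<open>r\<close> in the curve equation produced
    \<open>quad_char r = \<xi> r ^ 6\<close>, which turns the exponent \<open>-3\<close> into
    \<open>3\<close>.\<close>
  have r3: "char_power \<xi> (-3) (1 - t) * quad_char r = \<xi> r ^ 3"
    using r by (simp add: char_power_def quad_char_eq r_def[symmetric] power_int_minus field_simps
        xi_simps power_add[symmetric])
  have "quad_char (2 :: 'p mod_ring) * \<xi> r ^ 3 * ?Q = \<xi> (4 * r) ^ 3 * ?Q"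
  proof -
    have "\<xi> 4 = \<xi> 2 ^ 2" using mult_char_mult[OF xi, of 2 2] by (simp add: power2_eq_square)
    then have "\<xi> (4 * r) ^ 3 = quad_char (2 :: 'p mod_ring) * \<xi> r ^ 3"
      by (simp add: mult_char_mult[OF xi] power_mult_distrib quad_char_eq power_mult[symmetric])
    then show ?thesis by simp
  qed
  also have "\<dots> = \<xi> (4 * r) ^ 12 * (\<xi> (4 * r) * ?S)"
    unfolding cubic_sum_eq[OF r(1)] by (simp add: mult.assoc[symmetric] power_add[symmetric]
        power_Suc2[symmetric])
  also have "\<dots> = ?F"
    unfolding quadratic_sum_eq[OF r] using xi_power_12[of "4 * r"] r four_neq_0 by simp
  finally have "quad_char (2 :: 'p mod_ring) * \<xi> r ^ 3 * ?Q = ?F" .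
  moreover have "- quad_char (2 :: 'p mod_ring) * char_power \<xi> (-3) (1 - t) * of_int (curve_trace t)
      = quad_char (2 :: 'p mod_ring) * (char_power \<xi> (-3) (1 - t) * quad_char r) * ?Q"
    unfolding T by simp
  ultimately show ?thesis unfolding F r3 by simp
qed

end

theorem theorem1p2:
  fixes \<xi> :: "'p::prime_card mod_ring \<Rightarrow> complex"
    and t :: "'p mod_ring"
    and p :: nat
  assumes "p = CARD('p)"
    and "[p = 1] (mod 12)"
    and "\<xi> \<in> mult_chars"
    and "char_order \<xi> = 12"
    and "t \<noteq> 0"
    and "t \<noteq> 1"
  shows "of_nat p * greene_2F1 \<xi> (char_power \<xi> 5) triv_char t =
         - quad_char (2 :: 'p mod_ring) * char_power \<xi> (-3) (1 - t) * of_int (curve_trace t)"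
  using greene_2F1_eq_curve_trace[of \<xi> t] assms by simp

end
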